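(* Let $G$ be an abelian group and let $D$ be an $h$-reduced connected alternating $G$-labeled virtual link diagram for a virtual link $L$. Then $\operatorname{breadth}_A(\mathcal{A}'(L))=4c(D)-4g(D)+4$, where $c(D)$ is the number of crossings of $D$ and $g(D)$ is the genus of the closed oriented surface that $D$ cellularly embeds into.
   Context: A virtual link diagram is a ribbon graph with oriented edges, whose degree-4 vertices (crossings) carry over/under information; gluing disks to the boundary components of the ribbon graph gives its cellular embedding as a link diagram on a closed oriented surface $\Sigma$ all of whose complementary regions are disks. This represents an oriented link $L\subset\Sigma\times I$, $I=[0,1]$, framed by annuli parallel to $\Sigma$. Let $\pi:\Sigma\times I\to\Sigma$ be the projection. The diagram is alternating if over- and under-crossings alternate along each component. For an abelian group $G$, a $G$-labeling of $L=L_1\sqcup\dots\sqcup L_n$ is a homomorphism $\lambda:H_0(L)\to G$, i.e. an element $\lambda_i\in G$ for each component $L_i$. With $\cdot$ the algebraic intersection number on $H_1(\Sigma)$, define $h_{L,\lambda}:H_1(\Sigma)\to G$ by $h_{L,\lambda}(\alpha)=\sum_i(\pi_*([L_i])\cdot\alpha)\lambda_i$. A $G$-labeled surface link diagram is $h$-reduced if every simple closed curve $C$ in the surface that intersects the diagram through a single crossing (i.e. meets the diagram only in one crossing point, passing there between opposite regions) satisfies $h_{L,\lambda}([C])\ne0$; for a virtual link diagram this refers to its cellular embedding. Let $R_G=\mathbb{Z}[A^{\pm1}][X_{\pm g}\mid g\in G]/(X_0-1)$, with one variable $X_{\pm g}$ for each unordered pair $\{g,-g\}$. A state $S$ of $D$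 is the simple closed multicurve obtained by choosing at each crossing the $A$-smoothing (joining the two regions swept out by rotating the overstrand counterclockwise) or the $B$-smoothing (joining the other two regions); $a(S)$, $b(S)$ are the numbers of $A$- and $B$-smoothings, and $i(S)$ is the number of loops $C\subseteq S$ with $h_{L,\lambda}([C])=0$. Then $$\mathcal{A}'(L)=\sum_S A^{a(S)-b(S)}(-A^2-A^{-2})^{i(S)}\prod_{C\in S}X_{\pm h_{L,\lambda}([C])}\in R_G,$$ where $C$ ranges over components of $S$, each given an arbitrary orientation. For nonzero $p\in R_G$, $\operatorname{breadth}_A p$ is the maximal minus the minimal degree of $A$ appearing in the monomials of $p$. *)

theory Defs
  imports
    Complex_Main
    "HOL-Library.Poly_Mapping"
    "HOL-Library.Product_Plus"
    "HOL-Combinatorics.Permutations"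
    "HOL-Combinatorics.Orbits"
begin

section \<open>Virtual link diagrams\<close>

text \<open>
  An oriented ribbon graph is given by its half-edges, the permutation \<open>rot\<close> sending a half-edge to
  the next one counterclockwise around its vertex, and the involution \<open>opp\<close> sending a half-edge to
  the other half of its edge.  The set \<open>out\<close> consists of the half-edges along which the orientation
  of the edge points away from the vertex, and \<open>over\<close> of the half-edges lying on the overstrand of
  their crossing.
\<close>

record 'h vdiagram =
  half :: "'h set"
  rot :: "'h \<Rightarrow> 'h"
  opp :: "'h \<Rightarrow> 'h"
  out :: "'h set"
  over :: "'h set"

definition vertex_of :: "('h, 'b) vdiagram_scheme \<Rightarrow> 'h \<Rightarrow> 'h set" where
  "vertex_of D h = orbit (rot D) h"

definition vertices :: "('h, 'b) vdiagram_scheme \<Rightarrow> 'h set set" where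
  "vertices D = vertex_of D ` half D"

definition at_crossing :: "('h, 'b) vdiagram_scheme \<Rightarrow> 'h \<Rightarrow> bool" where
  "at_crossing D h \<longleftrightarrow> h \<in> half D \<and> card (vertex_of D h) = 4"

definition crossings :: "('h, 'b) vdiagram_scheme \<Rightarrow> 'h set set" where
  "crossings D = {v \<in> vertices D. card v = 4}"

text \<open>
  A component without crossings is drawn as a loop with a single bivalent vertex, which is not a
  crossing; this is the only use of vertices of degree other than 4.
\<close>

definition virtual_link_diagram :: "('h, 'b) vdiagram_scheme \<Rightarrow> bool" where
  "virtual_link_diagram D \<longleftrightarrow>
     finite (half D) \<and> rot D permutes half D \<and> opp D permutes half D \<and>
     out D \<subseteq> half D \<and> over D \<subseteq> {h. at_crossing D h} \<and>
     (\<forall>h \<in> half D. opp D h \<noteq> h \<and> opp D (opp D h) = h) \<and>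
     (\<forall>h \<in> half D. card (vertex_of D h) = 4 \<or> (card (vertex_of D h) = 2 \<and> opp D h = rot D h)) \<and>
     (\<forall>h \<in> half D. opp D h \<in> out D \<longleftrightarrow> h \<notin> out D) \<and>
     (\<forall>h. at_crossing D h \<longrightarrow> (rot D (rot D h) \<in> out D \<longleftrightarrow> h \<notin> out D)) \<and>
     (\<forall>h. at_crossing D h \<longrightarrow> (rot D h \<in> over D \<longleftrightarrow> h \<notin> over D))"

definition connected_diagram :: "('h, 'b) vdiagram_scheme \<Rightarrow> bool" where
  "connected_diagram D \<longleftrightarrow> half D \<noteq> {} \<and>
     (\<forall>h \<in> half D. \<forall>k \<in> half D.
        (h, k) \<in> {(x, y). x \<in> half D \<and> (y = rot D x \<or> y = opp D x)}\<^sup>*)"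

text \<open>Following any edge from one crossing to the next switches between over and under.\<close>

definition alternating :: "('h, 'b) vdiagram_scheme \<Rightarrow> bool" where
  "alternating D \<longleftrightarrow> (\<forall>h. at_crossing D h \<longrightarrow> (opp D h \<in> over D \<longleftrightarrow> h \<notin> over D))"


section \<open>The surface\<close>

text \<open>
  A half-edge \<open>h\<close> stands for the corner between \<open>h\<close> and \<open>rot h\<close>, which lies to the left of \<open>h\<close> when
  \<open>h\<close> is traversed away from its vertex.  The boundary component of the ribbon graph to the left of
  \<open>h\<close> continues along the half-edge that precedes \<open>opp h\<close> around the next vertex.
\<close>

definition face_perm :: "('h, 'b) vdiagram_scheme \<Rightarrow> 'h \<Rightarrow> 'h" where
  "face_perm D h = inv (rot D) (opp D h)"

definition face_of :: "('h, 'b) vdiagram_scheme \<Rightarrow> 'h \<Rightarrow> 'h set" where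
  "face_of D h = orbit (face_perm D) h"

definition faces :: "('h, 'b) vdiagram_scheme \<Rightarrow> 'h set set" where
  "faces D = face_of D ` half D"

definition edges :: "('h, 'b) vdiagram_scheme \<Rightarrow> 'h set set" where
  "edges D = (\<lambda>h. {h, opp D h}) ` half D"

definition euler_char :: "('h, 'b) vdiagram_scheme \<Rightarrow> int" where
  "euler_char D = int (card (vertices D)) - int (card (edges D)) + int (card (faces D))"

text \<open>For connected diagrams, when the surface is connected as well.\<close>

definition genus :: "('h, 'b) vdiagram_scheme \<Rightarrow> int" where
  "genus D = (2 - euler_char D) div 2"

text \<open>
  The first homology group of the surface, computed from the cell structure dual to the diagram: a
  0-cell in each face, a 1-cell across each edge and a 2-cell around each vertex.  Thus 1-chains
  describe curves in general position with respect to the diagram.  A chain is given by a function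
  \<open>c\<close> on half-edges, where \<open>c h\<close> is the net number of times that the curve crosses the edge of \<open>h\<close>
  from the right of \<open>h\<close> to the left of \<open>h\<close> (\<open>h\<close> pointing away from its vertex).
\<close>

definition chains :: "('h, 'b) vdiagram_scheme \<Rightarrow> ('h \<Rightarrow> int) set" where
  "chains D = {c. (\<forall>h \<in> half D. c (opp D h) = - c h) \<and> (\<forall>h. h \<notin> half D \<longrightarrow> c h = 0)}"

definition cycles :: "('h, 'b) vdiagram_scheme \<Rightarrow> ('h \<Rightarrow> int) set" where
  "cycles D = {c \<in> chains D. \<forall>f \<in> faces D. (\<Sum>h\<in>f. c h) = 0}"

text \<open>The boundary of the combination of 2-cells in which the one around \<open>v\<close> has coefficient \<open>u v\<close>.\<close>

definition boundary :: "('h, 'b) vdiagram_scheme \<Rightarrow> ('h set \<Rightarrow> int) \<Rightarrow> 'h \<Rightarrow> int" where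
  "boundary D u h = (if h \<in> half D then u (vertex_of D h) - u (vertex_of D (opp D h)) else 0)"

definition homologous :: "('h, 'b) vdiagram_scheme \<Rightarrow> (('h \<Rightarrow> int) \<times> ('h \<Rightarrow> int)) set" where
  "homologous D = {(c, c'). c \<in> cycles D \<and> c' \<in> cycles D \<and> (\<exists>u. \<forall>h. c' h - c h = boundary D u h)}"

definition H1 :: "('h, 'b) vdiagram_scheme \<Rightarrow> ('h \<Rightarrow> int) set set" where
  "H1 D = cycles D // homologous D"

definition hclass :: "('h, 'b) vdiagram_scheme \<Rightarrow> ('h \<Rightarrow> int) \<Rightarrow> ('h \<Rightarrow> int) set" where
  "hclass D c = homologous D `` {c}"


section \<open>Labelings and the homomorphism they induce\<close>

definition across :: "('h, 'b) vdiagram_scheme \<Rightarrow> 'h \<Rightarrow> 'h" where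
  "across D h = (if at_crossing D h then rot D (rot D h) else rot D h)"

definition strand :: "('h, 'b) vdiagram_scheme \<Rightarrow> 'h \<Rightarrow> 'h" where
  "strand D h = across D (opp D h)"

text \<open>
  A component of the link is the set of its oriented edges, each represented by its outgoing
  half-edge.  A \<open>G\<close>-labeling is a function \<open>lab\<close> from components to \<open>G\<close>.
\<close>

definition link_components :: "('h, 'b) vdiagram_scheme \<Rightarrow> 'h set set" where
  "link_components D = (\<lambda>h. orbit (strand D) h) ` out D"

text \<open>
  The intersection number of the class of the component \<open>K\<close> with \<open>a\<close>; a crossing of
  \<open>K\<close> by the curve from right to left is positive.
\<close>

definition intersection_number ::
    "('h, 'b) vdiagram_scheme \<Rightarrow> 'h set \<Rightarrow> ('h \<Rightarrow> int) set \<Rightarrow> int" where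
  "intersection_number D K a = (THE n. \<forall>c \<in> a. (\<Sum>h\<in>K. c h) = n)"

definition int_mult :: "int \<Rightarrow> 'g::ab_group_add \<Rightarrow> 'g" where
  "int_mult n g = (\<Sum>i<nat n. g) - (\<Sum>i<nat (- n). g)"

definition h_map ::
    "('h, 'b) vdiagram_scheme \<Rightarrow> ('h set \<Rightarrow> 'g) \<Rightarrow> ('h \<Rightarrow> int) set \<Rightarrow> 'g::ab_group_add" where
  "h_map D lab a = (\<Sum>K\<in>link_components D. int_mult (intersection_number D K a) (lab K))"


section \<open>Curves on the surface\<close>

text \<open>The chain crossing \<open>h\<close> once, from right to left.\<close>

definition cross :: "('h, 'b) vdiagram_scheme \<Rightarrow> 'h \<Rightarrow> 'h \<Rightarrow> int" where
  "cross D h k = (if k = h then 1 else 0) - (if k = opp D h then 1 else 0)"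

text \<open>
  A short arc that goes counterclockwise around a vertex, from the corner before \<open>h\<close> to the corner
  after \<open>rot h\<close>.
\<close>

definition turn :: "('h, 'b) vdiagram_scheme \<Rightarrow> 'h \<Rightarrow> 'h \<Rightarrow> int" where
  "turn D h k = cross D h k + cross D (rot D h) k"

text \<open>
  The corners \<open>h\<close> and \<open>rot (rot h)\<close> are opposite at their crossing.  A simple closed curve meeting the
  diagram only in this crossing and passing between these corners exists iff they lie in the same
  face; it returns through this face.  As faces are disks it is unique up to isotopy and reversal.
  Pushing it off the crossing gives the following cycle.
\<close>

definition crossing_curve :: "('h, 'b) vdiagram_scheme \<Rightarrow> 'h \<Rightarrow> 'h \<Rightarrow> int" where
  "crossing_curve D h = turn D (rot D h)"

definition h_reduced ::
    "('h, 'b) vdiagram_scheme \<Rightarrow> ('h set \<Rightarrow> 'g::ab_group_add) \<Rightarrow> bool" where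
  "h_reduced D lab \<longleftrightarrow>
     (\<forall>h. at_crossing D h \<and> face_of D h = face_of D (rot D (rot D h)) \<longrightarrow>
        h_map D lab (hclass D (crossing_curve D h)) \<noteq> 0)"

text \<open>
  A state is the set \<open>S\<close> of its \<open>A\<close>-smoothed crossings.  Rotating the overstrand counterclockwise
  sweeps out the corners \<open>h\<close> with \<open>h\<close> over.  The \<open>A\<close>-smoothing joins these two regions, hence its two
  arcs cut off the other two corners: they join each under half-edge \<open>k\<close> to \<open>rot k\<close>.
  \<open>smoothing D S h\<close> is the half-edge joined to \<open>h\<close>.
\<close>

definition smoothing :: "('h, 'b) vdiagram_scheme \<Rightarrow> 'h set set \<Rightarrow> 'h \<Rightarrow> 'h" where
  "smoothing D S h =
     (if (vertex_of D h \<in> S) = (h \<in> over D) then inv (rot D) h else rot D h)"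

definition states :: "('h, 'b) vdiagram_scheme \<Rightarrow> 'h set set set" where
  "states D = Pow (crossings D)"

definition loop_next :: "('h, 'b) vdiagram_scheme \<Rightarrow> 'h set set \<Rightarrow> 'h \<Rightarrow> 'h" where
  "loop_next D S h = smoothing D S (opp D h)"

definition directed_loop :: "('h, 'b) vdiagram_scheme \<Rightarrow> 'h set set \<Rightarrow> 'h \<Rightarrow> 'h set" where
  "directed_loop D S h = orbit (loop_next D S) h"

definition loops :: "('h, 'b) vdiagram_scheme \<Rightarrow> 'h set set \<Rightarrow> 'h set set" where
  "loops D S = (\<lambda>h. directed_loop D S h \<union> opp D ` directed_loop D S h) ` half D"

text \<open>
  The cycle of the loop through \<open>h\<close>, directed along \<open>h\<close> away from its vertex and pushed off
  to its left.  Where it turns left the pushed-off curve stays in the same corner and meets no edge;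
  where it turns right, from \<open>x\<close> to \<open>rot x\<close>, it crosses \<open>x\<close> and \<open>rot x\<close>.
\<close>

definition loop_cycle ::
    "('h, 'b) vdiagram_scheme \<Rightarrow> 'h set set \<Rightarrow> 'h \<Rightarrow> 'h \<Rightarrow> int" where
  "loop_cycle D S h k =
     (\<Sum>x \<in> opp D ` directed_loop D S h.
        if smoothing D S x = inv (rot D) x then 0 else turn D x k)"

text \<open>The value on the loop \<open>C\<close> with an arbitrary orientation.\<close>

definition loop_value ::
    "('h, 'b) vdiagram_scheme \<Rightarrow> ('h set \<Rightarrow> 'g) \<Rightarrow> 'h set set \<Rightarrow> 'h set \<Rightarrow> 'g::ab_group_add" where
  "loop_value D lab S C = h_map D lab (hclass D (loop_cycle D S (SOME h. h \<in> C)))"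

definition null_loops ::
    "('h, 'b) vdiagram_scheme \<Rightarrow> ('h set \<Rightarrow> 'g::ab_group_add) \<Rightarrow> 'h set set \<Rightarrow> nat" where
  "null_loops D lab S = card {C \<in> loops D S. loop_value D lab S C = 0}"


section \<open>Well-definedness\<close>

text \<open>
  The curves above are cycles, so they have classes in \<open>H1\<close>, and the intersection number with
  a component of the link can be computed from any cycle in the class.
\<close>

context
  fixes D :: "('h, 'b) vdiagram_scheme"
  assumes D: "virtual_link_diagram D"
begin

lemma finite_half: "finite (half D)"
  and rot_permutes: "rot D permutes half D"
  and opp_permutes: "opp D permutes half D"
  and opp_opp: "h \<in> half D \<Longrightarrow> opp D (opp D h) = h"
  and opp_neq: "h \<in> half D \<Longrightarrow> opp D h \<noteq> h"
  using D by (auto simp: virtual_link_diagram_def)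

lemma rot_permutation: "permutation (rot D)"
  using finite_half rot_permutes by (auto simp: permutation_permutes)

lemma rot_in_half: "rot D h \<in> half D \<longleftrightarrow> h \<in> half D"
  by (rule permutes_in_image [OF rot_permutes])

lemma opp_in_half: "opp D h \<in> half D \<longleftrightarrow> h \<in> half D"
  by (rule permutes_in_image [OF opp_permutes])

lemma rot_inv: "rot D (inv (rot D) h) = h" "inv (rot D) (rot D h) = h"
  using permutes_inverses [OF rot_permutes] by auto

lemma inv_rot_in_half: "inv (rot D) h \<in> half D \<longleftrightarrow> h \<in> half D"
  by (rule permutes_in_image [OF permutes_inv [OF rot_permutes]])

lemma vertex_of_rot: "vertex_of D (rot D h) = vertex_of D h"
  unfolding vertex_of_def by (rule permutation_orbit_step [OF rot_permutation])

lemma vertex_of_inv_rot: "vertex_of D (inv (rot D) h) = vertex_of D h"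
  using vertex_of_rot [of "inv (rot D) h"] by (simp add: rot_inv)

lemma vertex_of_across: "vertex_of D (across D h) = vertex_of D h"
  by (simp add: across_def vertex_of_rot)

lemma face_perm_permutes: "face_perm D permutes half D"
proof -
  have "face_perm D = inv (rot D) \<circ> opp D"
    by (rule ext) (simp add: face_perm_def)
  then show ?thesis
    using permutes_compose [OF opp_permutes permutes_inv [OF rot_permutes]] by simp
qed

lemma face_of_step: "face_of D (face_perm D h) = face_of D h"
  unfolding face_of_def
  by (rule permutation_orbit_step) (use finite_half face_perm_permutes in \<open>auto simp: permutation_permutes\<close>)

lemma face_of_opp_rot: "h \<in> half D \<Longrightarrow> face_of D (opp D (rot D h)) = face_of D h"
  using face_of_step [of "opp D (rot D h)"] by (simp add: face_perm_def opp_opp rot_in_half rot_inv)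

lemma face_of_inv_rot: "face_of D (inv (rot D) (opp D h)) = face_of D h"
  using face_of_step [of h] by (simp add: face_perm_def)

lemma in_face_iff:
  assumes "f \<in> faces D" "h \<in> half D"
  shows "h \<in> f \<longleftrightarrow> face_of D h = f"
proof -
  have c: "cyclic_on (face_perm D) (face_of D k)" for k
    unfolding face_of_def by (rule cyclic_on_orbit [OF face_perm_permutes finite_half])
  have "h \<in> face_of D h"
    unfolding face_of_def
    by (rule permutation_self_in_orbit)
       (use finite_half face_perm_permutes in \<open>auto simp: permutation_permutes\<close>)
  moreover from assms obtain k where f: "f = face_of D k" by (auto simp: faces_def)
  have "h \<in> face_of D k \<Longrightarrow> face_of D h = face_of D k"
    using orbit_cyclic_eq3 [OF c] by (simp add: face_of_def)
  ultimately show ?thesis by (auto simp: f)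
qed

lemma finite_face: "f \<in> faces D \<Longrightarrow> finite f"
  using permutes_orbit_subset [OF face_perm_permutes] finite_half
  by (auto simp: faces_def face_of_def intro: finite_subset)

lemma cross_in_chains:
  assumes "h \<in> half D"
  shows "cross D h \<in> chains D"
proof -
  have "opp D k = h \<longleftrightarrow> k = opp D h" if "k \<in> half D" for k
    using that assms opp_opp by metis
  moreover have "opp D k = opp D h \<longleftrightarrow> k = h" for k
    using permutes_inj [OF opp_permutes] by (auto dest: injD)
  ultimately show ?thesis
    using assms by (auto simp: chains_def cross_def opp_in_half)
qed

lemma sum_face_cross:
  assumes "f \<in> faces D" "h \<in> half D"
  shows "(\<Sum>k\<in>f. cross D h k) = of_bool (face_of D h = f) - of_bool (face_of D (opp D h) = f)"
proof -
  have "(\<Sum>k\<in>f. cross D h k) = of_bool (h \<in> f) - of_bool (opp D h \<in> f)"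
    using finite_face [OF assms(1)] by (simp add: cross_def sum_subtractf of_bool_def)
  then show ?thesis
    using assms by (simp add: in_face_iff opp_in_half)
qed

lemma turn_in_chains:
  assumes "h \<in> half D"
  shows "turn D h \<in> chains D"
  using cross_in_chains [of h] cross_in_chains [of "rot D h"] assms
  by (simp add: chains_def turn_def rot_in_half)

lemma sum_face_turn:
  assumes "f \<in> faces D" "h \<in> half D"
  shows "(\<Sum>k\<in>f. turn D h k)
       = of_bool (face_of D (rot D h) = f) - of_bool (face_of D (opp D h) = f)"
  using assms
  by (simp add: turn_def sum.distrib sum_face_cross rot_in_half face_of_opp_rot)

lemma crossing_curve_cycle:
  assumes "at_crossing D h" "face_of D h = face_of D (rot D (rot D h))"
  shows "crossing_curve D h \<in> cycles D"
proof -
  have "h \<in> half D" using assms by (simp add: at_crossing_def)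
  then show ?thesis
    using assms
    by (simp add: cycles_def crossing_curve_def turn_in_chains rot_in_half sum_face_turn
        face_of_opp_rot)
qed

lemma smoothing_in_half: "smoothing D S h \<in> half D \<longleftrightarrow> h \<in> half D"
  by (simp add: smoothing_def rot_in_half inv_rot_in_half)

lemma smoothing_smoothing:
  assumes h: "h \<in> half D"
  shows "smoothing D S (smoothing D S h) = h"
proof (cases "card (vertex_of D h) = 4")
  case True
  have over: "rot D k \<in> over D \<longleftrightarrow> k \<notin> over D" if "at_crossing D k" for k
    using D that by (simp add: virtual_link_diagram_def)
  have 1: "rot D h \<in> over D \<longleftrightarrow> h \<notin> over D"
    using over [of h] True h by (simp add: at_crossing_def)
  have 2: "inv (rot D) h \<in> over D \<longleftrightarrow> h \<notin> over D"
    using over [of "inv (rot D) h"] True h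
    by (simp add: at_crossing_def inv_rot_in_half vertex_of_inv_rot rot_inv)
  show ?thesis
    using 1 2 by (simp add: smoothing_def vertex_of_rot vertex_of_inv_rot rot_inv)
next
  case False
  have opp_rot: "opp D k = rot D k" if "k \<in> half D" "vertex_of D k = vertex_of D h" for k
    using D that False by (auto simp: virtual_link_diagram_def)
  have "rot D (rot D h) = h"
    using opp_rot [of h] opp_rot [of "rot D h"] h opp_opp [OF h]
    by (simp add: rot_in_half vertex_of_rot)
  then have "inv (rot D) h = rot D h" "inv (rot D) (rot D h) = h"
    by (metis rot_inv(2))+
  then show ?thesis
    using \<open>rot D (rot D h) = h\<close> by (simp add: smoothing_def)
qed

lemma loop_next_permutes_half: "bij_betw (loop_next D S) (half D) (half D)"
  by (rule bij_betw_byWitness [where f' = "\<lambda>h. opp D (smoothing D S h)"])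
     (auto simp: loop_next_def smoothing_smoothing opp_opp opp_in_half smoothing_in_half)

lemma directed_loop_props:
  assumes h: "h \<in> half D"
  shows "directed_loop D S h \<subseteq> half D" "h \<in> directed_loop D S h"
    and "loop_next D S ` directed_loop D S h = directed_loop D S h"
proof -
  let ?f = "loop_next D S"
  define g where "g = perm_restrict ?f (half D)"
  have g: "g permutes half D"
    unfolding g_def perm_restrict_def
    using loop_next_permutes_half [of S]
    by (intro bij_imp_permutes) (auto cong: bij_betw_cong)
  have gf: "g k = ?f k" if "k \<in> half D" for k
    using that by (simp add: g_def perm_restrict_def)
  have sub: "orbit g h \<subseteq> half D"
    by (rule permutes_orbit_subset [OF g h])
  have self: "h \<in> orbit g h"
    using finite_half g by (intro permutation_self_in_orbit) (auto simp: permutation_permutes)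
  have eq: "directed_loop D S h = orbit g h"
    unfolding directed_loop_def
    by (rule orbit_cong0 [where A = "half D"])
       (use h in \<open>auto simp: gf loop_next_def smoothing_in_half opp_in_half\<close>)
  have "g ` orbit g h = orbit g h"
  proof
    show "g ` orbit g h \<subseteq> orbit g h" by (auto intro: orbit.intros)
    show "orbit g h \<subseteq> g ` orbit g h"
    proof
      fix x assume "x \<in> orbit g h"
      then show "x \<in> g ` orbit g h" using self by cases auto
    qed
  qed
  moreover have "?f ` orbit g h = g ` orbit g h"
    using sub by (intro image_cong) (auto simp: gf)
  ultimately show "directed_loop D S h \<subseteq> half D" "h \<in> directed_loop D S h"
    "?f ` directed_loop D S h = directed_loop D S h"
    using sub self by (simp_all add: eq)
qed

lemma loop_cycle_cycle:
  assumes h: "h \<in> half D"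
  shows "loop_cycle D S h \<in> cycles D"
proof -
  let ?O = "directed_loop D S h" and ?f = "loop_next D S"
  let ?t = "\<lambda>x k. if smoothing D S x = inv (rot D) x then 0 else turn D x k"
  have O: "k \<in> half D" if "k \<in> ?O" for k
    using directed_loop_props(1) [OF h] that by auto
  have finO: "finite ?O"
    using directed_loop_props(1) [OF h] finite_half by (rule finite_subset)
  have inj_opp: "inj_on (opp D) ?O"
    by (rule inj_on_subset [OF permutes_inj [OF opp_permutes]]) simp
  have inj_f: "inj_on ?f ?O"
    using finO directed_loop_props(3) [OF h] by (simp add: eq_card_imp_inj_on)
  have t: "?t x \<in> chains D" if "x \<in> half D" for x
    using turn_in_chains [OF that] by (simp add: chains_def)
  have "loop_cycle D S h \<in> chains D"
    using t O by (auto simp: chains_def loop_cycle_def opp_in_half sum_negf [symmetric]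
        intro!: sum.cong sum.neutral)
  moreover have "(\<Sum>k\<in>f. loop_cycle D S h k) = 0" if f: "f \<in> faces D" for f
  proof -
    let ?i = "\<lambda>x. of_bool (face_of D x = f) :: int"
    have step: "(\<Sum>k\<in>f. ?t (opp D x) k) = ?i (?f x) - ?i x" if "x \<in> ?O" for x
    proof (cases "smoothing D S (opp D x) = inv (rot D) (opp D x)")
      case True
      then show ?thesis by (simp add: loop_next_def face_of_inv_rot)
    next
      case False
      then have "?f x = rot D (opp D x)"
        by (auto simp: loop_next_def smoothing_def split: if_splits)
      then show ?thesis
        using False O [OF that] f by (simp add: sum_face_turn opp_in_half opp_opp)
    qed
    have "(\<Sum>k\<in>f. loop_cycle D S h k) = (\<Sum>x\<in>?O. \<Sum>k\<in>f. ?t (opp D x) k)"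
      unfolding loop_cycle_def sum.reindex [OF inj_opp] comp_def by (rule sum.swap)
    also have "\<dots> = (\<Sum>x\<in>?O. ?i (?f x)) - (\<Sum>x\<in>?O. ?i x)"
      by (simp add: step sum_subtractf)
    also have "(\<Sum>x\<in>?O. ?i (?f x)) = (\<Sum>x\<in>?f ` ?O. ?i x)"
      by (simp add: sum.reindex [OF inj_f])
    finally show ?thesis
      by (simp add: directed_loop_props(3) [OF h])
  qed
  ultimately show ?thesis by (simp add: cycles_def)
qed

lemma strand_permutes_out: "bij_betw (strand D) (out D) (out D)"
proof -
  have across: "across D (across D k) = k \<and> (across D k \<in> out D \<longleftrightarrow> k \<notin> out D)"
    if k: "k \<in> half D" for k
  proof (cases "at_crossing D k")
    case True
    then have c: "card (vertex_of D k) = 4" by (simp add: at_crossing_def)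
    have k_orbit: "k \<in> orbit (rot D) k"
      by (rule permutation_self_in_orbit [OF rot_permutation])
    have "card (vertex_of D k) = funpow_dist1 (rot D) k k"
      unfolding vertex_of_def
      by (subst orbit_conv_funpow_dist1 [OF k_orbit])
         (simp only: card_image [OF inj_on_funpow_dist1 [OF k_orbit]] card_atLeastLessThan diff_zero)
    then have "(rot D ^^ card (vertex_of D k)) k = k"
      using funpow_dist1_prop [OF k_orbit] by simp
    then have "rot D (rot D (rot D (rot D k))) = k"
      by (simp add: c numeral_eq_Suc)
    moreover have "at_crossing D (rot D (rot D k))"
      using True by (simp add: at_crossing_def rot_in_half vertex_of_rot)
    ultimately show ?thesis
      using True D by (simp add: across_def virtual_link_diagram_def)
  next
    case False
    have opp_rot: "opp D j = rot D j" if "j \<in> half D" "vertex_of D j = vertex_of D k" for j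
      using D that False k by (auto simp: virtual_link_diagram_def at_crossing_def)
    have "across D k = opp D k"
      using False opp_rot [of k] k by (simp add: across_def)
    moreover have "across D (opp D k) = k"
      using False opp_rot [of k] opp_rot [of "rot D k"] opp_opp [OF k] k
      by (simp add: across_def at_crossing_def rot_in_half vertex_of_rot)
    ultimately show ?thesis
      using D k by (simp add: virtual_link_diagram_def)
  qed
  have in_half: "across D k \<in> half D \<longleftrightarrow> k \<in> half D" for k
    by (simp add: across_def rot_in_half)
  have opp_out: "opp D k \<in> out D \<longleftrightarrow> k \<notin> out D" if "k \<in> half D" for k
    using D that by (simp add: virtual_link_diagram_def)
  have out: "out D \<subseteq> half D"
    using D by (simp add: virtual_link_diagram_def)
  show ?thesis
    by (rule bij_betw_byWitness [where f' = "\<lambda>h. opp D (across D h)"])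
       (use out in \<open>auto simp: strand_def across opp_opp opp_in_half in_half opp_out subset_iff\<close>)
qed

lemma sum_boundary_component:
  assumes "K \<in> link_components D"
  shows "(\<Sum>h\<in>K. boundary D u h) = 0"
proof -
  from assms obtain h where h: "h \<in> out D" and K: "K = orbit (strand D) h"
    by (auto simp: link_components_def)
  have out: "out D \<subseteq> half D"
    using D by (simp add: virtual_link_diagram_def)
  have sub: "K \<subseteq> out D"
  proof
    fix x assume "x \<in> K"
    then show "x \<in> out D"
      unfolding K by induct (use h strand_permutes_out in \<open>auto dest: bij_betwE\<close>)
  qed
  have fin: "finite K"
    using sub out finite_half by (meson finite_subset)
  have inj: "inj_on (strand D) K"
    using strand_permutes_out sub by (auto simp: bij_betw_def intro: inj_on_subset)
  have "strand D ` K \<subseteq> K"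
    unfolding K by (auto intro: orbit.intros)
  then have eq: "strand D ` K = K"
    using fin inj by (simp add: card_image card_subset_eq)
  have "(\<Sum>h\<in>K. boundary D u h) = (\<Sum>h\<in>K. u (vertex_of D h) - u (vertex_of D (strand D h)))"
    using sub out by (intro sum.cong) (auto simp: boundary_def strand_def vertex_of_across)
  also have "\<dots> = (\<Sum>h\<in>K. u (vertex_of D h)) - (\<Sum>h\<in>strand D ` K. u (vertex_of D h))"
    by (simp add: sum_subtractf sum.reindex [OF inj])
  finally show ?thesis
    by (simp add: eq)
qed

lemma intersection_number_hclass:
  assumes "K \<in> link_components D" "c \<in> cycles D"
  shows "intersection_number D K (hclass D c) = (\<Sum>h\<in>K. c h)"
proof -
  have "(c, c) \<in> homologous D"
    using assms(2) by (auto simp: homologous_def boundary_def intro!: exI [of _ "\<lambda>_. 0"])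
  then have self: "c \<in> hclass D c"
    by (simp add: hclass_def)
  have eq: "(\<Sum>h\<in>K. c' h) = (\<Sum>h\<in>K. c h)" if "c' \<in> hclass D c" for c'
  proof -
    from that obtain u where "\<And>h. c' h - c h = boundary D u h"
      by (auto simp: hclass_def homologous_def)
    then have "(\<Sum>h\<in>K. c' h) - (\<Sum>h\<in>K. c h) = (\<Sum>h\<in>K. boundary D u h)"
      by (simp add: sum_subtractf [symmetric])
    then show ?thesis
      by (simp add: sum_boundary_component [OF assms(1)])
  qed
  show ?thesis
    unfolding intersection_number_def
  proof (rule the_equality)
    show "\<forall>c'\<in>hclass D c. (\<Sum>h\<in>K. c' h) = (\<Sum>h\<in>K. c h)"
      using eq by blast
    show "n = (\<Sum>h\<in>K. c h)" if "\<forall>c'\<in>hclass D c. (\<Sum>h\<in>K. c' h) = n" for n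
      using that self by metis
  qed
qed

end


section \<open>The ring of coefficients\<close>

quotient_type (overloaded) 'g upto_sign = "'g::ab_group_add" / "\<lambda>g h. h = g \<or> h = - g"
  by (auto simp: equivp_reflp_symp_transp reflp_def symp_def transp_def)

text \<open>
  Laurent polynomials in \<open>A\<close> and polynomials in the \<open>X\<close> variables: the pair \<open>(n, m)\<close> stands for the
  monomial whose exponents are \<open>n\<close> for \<open>A\<close> and \<open>m\<close> for the \<open>X\<close> variables.
\<close>

type_synonym 'g pre_ring = "(int \<times> ('g upto_sign \<Rightarrow>\<^sub>0 nat)) \<Rightarrow>\<^sub>0 int"

definition pre_A :: "int \<Rightarrow> 'g::ab_group_add pre_ring" where
  "pre_A n = frag_of (n, 0)"

definition pre_X :: "'g::ab_group_add upto_sign \<Rightarrow> 'g pre_ring" where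
  "pre_X x = frag_of (0, Poly_Mapping.single x 1)"

abbreviation X0_minus_1 :: "'g::ab_group_add pre_ring" where
  "X0_minus_1 \<equiv> pre_X (abs_upto_sign 0) - 1"

definition ideal_cong :: "'g::ab_group_add pre_ring \<Rightarrow> 'g pre_ring \<Rightarrow> bool" where
  "ideal_cong p q \<longleftrightarrow> X0_minus_1 dvd p - q"

lemma equivp_ideal_cong: "equivp (ideal_cong :: 'g::ab_group_add pre_ring \<Rightarrow> _)"
proof (rule equivpI)
  show "reflp (ideal_cong :: 'g pre_ring \<Rightarrow> _)"
    by (rule reflpI) (simp add: ideal_cong_def)
  show "symp (ideal_cong :: 'g pre_ring \<Rightarrow> _)"
  proof (rule sympI)
    fix p q :: "'g pre_ring"
    assume "ideal_cong p q"
    then have "X0_minus_1 dvd - (p - q)" by (simp only: ideal_cong_def dvd_minus_iff)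
    then show "ideal_cong q p" by (simp only: ideal_cong_def minus_diff_eq)
  qed
  show "transp (ideal_cong :: 'g pre_ring \<Rightarrow> _)"
  proof (rule transpI)
    fix p q r :: "'g pre_ring"
    assume "ideal_cong p q" "ideal_cong q r"
    then have "X0_minus_1 dvd (p - q) + (q - r)" unfolding ideal_cong_def by (rule dvd_add)
    then show "ideal_cong p r" by (simp only: ideal_cong_def diff_add_cancel add_diff_eq)
  qed
qed

text \<open>Substituting 1 for \<open>X\<^sub>0\<close>.\<close>

definition set_X0 :: "'g::ab_group_add pre_ring \<Rightarrow> 'g pre_ring" where
  "set_X0 = frag_extend (\<lambda>(n, m). frag_of (n, Poly_Mapping.update (abs_upto_sign 0) 0 m))"

lemma set_X0_mult_X0: "set_X0 (p * pre_X (abs_upto_sign 0)) = set_X0 p"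
proof (induction p rule: frag_induction [OF subset_UNIV])
  case 1
  then show ?case by simp
next
  case (2 nm)
  obtain n m where nm: "nm = (n, m)" by (cases nm)
  have "Poly_Mapping.update (abs_upto_sign 0) 0 (m + Poly_Mapping.single (abs_upto_sign 0) 1)
      = Poly_Mapping.update (abs_upto_sign 0) 0 m"
    by (rule poly_mapping_eqI) (simp add: lookup_update lookup_add lookup_single when_def)
  then show ?case
    by (simp add: nm set_X0_def pre_X_def mult_single)
next
  case (3 p q)
  then show ?case
    by (simp add: left_diff_distrib set_X0_def frag_extend_diff)
qed

lemma set_X0_cong:
  assumes "ideal_cong p q"
  shows "set_X0 p = set_X0 q"
proof -
  from assms obtain r where "p - q = X0_minus_1 * r" unfolding ideal_cong_def by (elim dvdE)
  then have "p = q + (r * pre_X (abs_upto_sign 0) - r)" by (simp add: algebra_simps)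
  then have "set_X0 p = set_X0 q + (set_X0 (r * pre_X (abs_upto_sign 0)) - set_X0 r)"
    by (simp add: set_X0_def frag_extend_add frag_extend_diff)
  then show ?thesis by (simp add: set_X0_mult_X0)
qed

lemma set_X0_one: "set_X0 1 = 1"
proof -
  have "Poly_Mapping.update (abs_upto_sign 0) 0 0 = (0 :: 'a upto_sign \<Rightarrow>\<^sub>0 nat)"
    by (rule poly_mapping_eqI) (simp add: lookup_update)
  then have "set_X0 (frag_of (0, 0)) = (frag_of (0, 0) :: 'a pre_ring)"
    by (simp add: set_X0_def)
  then show ?thesis
    unfolding zero_prod_def [symmetric] single_one .
qed

text \<open>So \<open>set_X0\<close> picks the representative without \<open>X\<^sub>0\<close> of each residue class.\<close>

lemma set_X0_rep: "ideal_cong p (set_X0 p)"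
  unfolding ideal_cong_def
proof (induction p rule: frag_induction [OF subset_UNIV])
  case 1
  then show ?case by (simp add: set_X0_def)
next
  case (2 nm)
  obtain n m where nm: "nm = (n, m)" by (cases nm)
  define x :: "'a upto_sign" where "x = abs_upto_sign 0"
  define m' where "m' = Poly_Mapping.update x 0 m"
  have pow: "pre_X x ^ k = frag_of (0, Poly_Mapping.single x k)" for k
    by (induction k)
       (simp_all add: pre_X_def mult_single single_add [symmetric] zero_prod_def [symmetric])
  have "m = m' + Poly_Mapping.single x (Poly_Mapping.lookup m x)"
    by (rule poly_mapping_eqI)
       (simp add: m'_def lookup_update lookup_add lookup_single when_def)
  then have "frag_of nm = frag_of (n, m') * pre_X x ^ Poly_Mapping.lookup m x"
    unfolding nm pow by (simp add: mult_single)
  moreover have "set_X0 (frag_of nm) = frag_of (n, m')"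
    by (simp add: set_X0_def nm m'_def x_def)
  ultimately have "frag_of nm - set_X0 (frag_of nm) =
      frag_of (n, m') * (pre_X x ^ Poly_Mapping.lookup m x - 1)"
    by (simp only: right_diff_distrib mult_1_right)
  moreover have "pre_X x - 1 dvd pre_X x ^ k - 1" for k
    by (simp add: power_diff_1_eq)
  ultimately show ?case
    unfolding x_def by simp
next
  case (3 p q)
  then have "X0_minus_1 dvd (p - set_X0 p) - (q - set_X0 q)" by (rule dvd_diff)
  then show ?case
    by (simp add: set_X0_def frag_extend_diff algebra_simps)
qed

quotient_type (overloaded) 'g R_ring = "'g::ab_group_add pre_ring" / ideal_cong
  by (rule equivp_ideal_cong)

instantiation R_ring :: (ab_group_add) comm_ring_1
begin

lift_definition zero_R_ring :: "'a R_ring" is 0 .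
lift_definition one_R_ring :: "'a R_ring" is 1 .
lift_definition plus_R_ring :: "'a R_ring \<Rightarrow> 'a R_ring \<Rightarrow> 'a R_ring" is "(+)"
proof -
  fix p q r s :: "'a pre_ring"
  assume "ideal_cong p q" "ideal_cong r s"
  then have "X0_minus_1 dvd (p - q) + (r - s)" unfolding ideal_cong_def by (rule dvd_add)
  then show "ideal_cong (p + r) (q + s)" by (simp only: ideal_cong_def add_diff_add)
qed
lift_definition uminus_R_ring :: "'a R_ring \<Rightarrow> 'a R_ring" is uminus
proof -
  fix p q :: "'a pre_ring"
  assume "ideal_cong p q"
  then have "X0_minus_1 dvd - (p - q)" by (simp only: ideal_cong_def dvd_minus_iff)
  then show "ideal_cong (- p) (- q)" by (simp only: ideal_cong_def minus_diff_minus)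
qed
lift_definition minus_R_ring :: "'a R_ring \<Rightarrow> 'a R_ring \<Rightarrow> 'a R_ring" is "(-)"
proof -
  fix p q r s :: "'a pre_ring"
  assume "ideal_cong p q" "ideal_cong r s"
  then have "X0_minus_1 dvd (p - q) - (r - s)" unfolding ideal_cong_def by (rule dvd_diff)
  then show "ideal_cong (p - r) (q - s)" by (simp add: ideal_cong_def algebra_simps)
qed
lift_definition times_R_ring :: "'a R_ring \<Rightarrow> 'a R_ring \<Rightarrow> 'a R_ring" is "(*)"
proof -
  fix p q r s :: "'a pre_ring"
  assume "ideal_cong p q" "ideal_cong r s"
  then have "X0_minus_1 dvd (p - q) * r + q * (r - s)"
    unfolding ideal_cong_def by (intro dvd_add dvd_mult dvd_mult2)
  then show "ideal_cong (p * r) (q * s)" by (simp add: ideal_cong_def algebra_simps)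
qed

instance
proof
  fix p q r :: "'a R_ring"
  show "p + q + r = p + (q + r)" by transfer (simp add: ideal_cong_def algebra_simps)
  show "p + q = q + p" by transfer (simp add: ideal_cong_def algebra_simps)
  show "0 + p = p" by transfer (simp add: ideal_cong_def)
  show "- p + p = 0" by transfer (simp add: ideal_cong_def)
  show "p - q = p + - q" by transfer (simp add: ideal_cong_def)
  show "p * q * r = p * (q * r)" by transfer (simp add: ideal_cong_def algebra_simps)
  show "p * q = q * p" by transfer (simp add: ideal_cong_def algebra_simps)
  show "1 * p = p" by transfer (simp add: ideal_cong_def)
  show "(p + q) * r = p * r + q * r" by transfer (simp add: ideal_cong_def algebra_simps)
  show "(0 :: 'a R_ring) \<noteq> 1"
  proof
    assume "(0 :: 'a R_ring) = 1"
    then have "ideal_cong 0 (1 :: 'a pre_ring)" by transfer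
    then have "set_X0 (0 :: 'a pre_ring) = set_X0 1" by (rule set_X0_cong)
    then show False unfolding set_X0_one by (simp add: set_X0_def)
  qed
qed

end

text \<open>\<open>A_power n\<close> is \<open>A\<^sup>n\<close>.\<close>

lift_definition A_power :: "int \<Rightarrow> 'g::ab_group_add R_ring" is pre_A .

lift_definition X_var :: "'g \<Rightarrow> 'g::ab_group_add R_ring" is "\<lambda>g. pre_X (abs_upto_sign g)" .

lemma X_var_zero: "X_var 0 = 1"
  by transfer (simp add: ideal_cong_def)

text \<open>
  The degrees of \<open>A\<close> in the monomials of an element of the ring, written in the basis of monomials
  without \<open>X\<^sub>0\<close>.
\<close>

lift_definition A_degrees :: "'g::ab_group_add R_ring \<Rightarrow> int set" is
  "\<lambda>p. fst ` Poly_Mapping.keys (set_X0 p)"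
  by (simp add: set_X0_cong)

text \<open>Only meaningful for nonzero \<open>p\<close>.\<close>

definition breadth_A :: "'g::ab_group_add R_ring \<Rightarrow> int" where
  "breadth_A p = Max (A_degrees p) - Min (A_degrees p)"


section \<open>The polynomial\<close>

definition arrow_poly ::
    "('h, 'b) vdiagram_scheme \<Rightarrow> ('h set \<Rightarrow> 'g::ab_group_add) \<Rightarrow> 'g R_ring" where
  "arrow_poly D lab =
     (\<Sum>S\<in>states D.
        A_power (int (card S) - int (card (crossings D - S)))
        * (- A_power 2 - A_power (- 2)) ^ null_loops D lab S
        * (\<Prod>C\<in>loops D S. X_var (loop_value D lab S C)))"

end

theory Submission
  imports Defs
begin

text \<open>
  The proof is a Kauffman--Murasugi--Thistlethwaite argument. A state \<open>S\<close> contributes monomials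
  whose \<open>A\<close>-degree is at most \<open>a(S) - b(S) + 2 i(S)\<close> and at least \<open>a(S) - b(S) - 2 i(S)\<close>. The
  point is that the all-\<open>A\<close> state is the only one for which the upper bound is largest, and that
  it attains this bound with coefficient \<open>1\<close> or \<open>-1\<close>; likewise the all-\<open>B\<close> state for the lower
  bound.

  Resmoothing one crossing cuts and reconnects the loops there, which changes \<open>i(S)\<close> by at most 1
  because homology classes add up when loops merge (\<open>null_orbits_reconnect\<close>). As \<open>a(S) - b(S)\<close>
  changes by 2, the bounds are monotone along a sequence of such moves that leads away from an
  extreme state. It remains to see that the first move changes the bound strictly
  (\<open>null_orbits_first_reconnect\<close>). In an alternating diagram the loops of the two extreme states
  run around the faces, so they are null-homologous. If the first move merges two of them, the
  result is one null loop instead of two. If it splits one of them, then its face meets the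
  crossing in two opposite corners, and the two pieces are, up to orientation, homologous to the
  curve through the crossing and that face, on which the homomorphism does not vanish by
  \<open>h\<close>-reducedness: no null loop is left instead of one.

  Hence the breadth is \<open>2 c + 2 (s\<^sub>A + s\<^sub>B)\<close> for the numbers \<open>s\<^sub>A\<close>, \<open>s\<^sub>B\<close> of loops in the extreme
  states. These loops correspond to the faces in the two classes of the checkerboard colouring, so
  \<open>s\<^sub>A + s\<^sub>B\<close> is the number of faces, and Euler's formula turns this into \<open>4 c - 4 g + 4\<close>. That
  the Euler characteristic is even, which division by 2 in the definition of the genus needs,
  follows from the same moves: each one changes the number of loops by exactly 1, so \<open>s\<^sub>A + s\<^sub>B\<close>
  and \<open>c\<close> have the same parity (\<open>even_card_faces\<close>).

  Loops are handled through a permutation. Both the edges and the smoothing arcs of an alternating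
  diagram join over half-edges to under half-edges. So each loop has exactly one direction in
  which it leaves every crossing along an over half-edge, loops are the orbits of a permutation of
  the over half-edges, and resmoothing a crossing composes this permutation with the transposition
  of its two over half-edges.
\<close>


section \<open>Reconnecting the orbits of a permutation\<close>

lemma orbit_subset_closed:
  assumes "x \<in> Y" "\<And>y. y \<in> Y \<Longrightarrow> g y \<in> Y"
  shows "orbit g x \<subseteq> Y"
proof
  fix y assume "y \<in> orbit g x"
  then show "y \<in> Y" by induct (use assms in auto)
qed

lemma orbit_eq_if_mem:
  assumes "permutation g" "y \<in> orbit g x"
  shows "orbit g y = orbit g x"
  using orbit_cyclic_eq3 [OF cyclic_on_orbit' [OF assms(1)] assms(2)] .

text \<open>
  The new orbit \<open>Y\<close> of \<open>p\<close> agrees with the old one until it would return to \<open>p\<close>, where it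
  continues at \<open>q\<close>. The proof shows that if \<open>Y\<close> avoided \<open>q\<close>, its part in the old orbit would be
  closed under \<open>g\<close> and therefore contain the preimage of \<open>p\<close>, which is now sent to \<open>q\<close>.
\<close>

lemma orbit_merge:
  assumes g: "permutation g" and "q \<notin> orbit g p"
  defines "g' \<equiv> transpose p q \<circ> g"
  shows "orbit g' p = orbit g p \<union> orbit g q"
proof -
  let ?P = "orbit g p" and ?Q = "orbit g q" and ?Y = "orbit g' p"
  have g': "permutation g'"
    unfolding g'_def by (intro permutation_compose g permutation_swap_id)
  have self: "p \<in> ?P" "q \<in> ?Q" "p \<in> ?Y"
    using g g' by (simp_all add: permutation_self_in_orbit)
  have disj: "?P \<inter> ?Q = {}"
    using orbit_eq_if_mem [OF g] self assms(2) by blast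
  have step: "g x = g' x" if "g x \<noteq> p" "g x \<noteq> q" for x
    using that by (simp add: g'_def)
  have g'_cases: "g' x \<in> ?P \<union> ?Q" if "x \<in> ?P \<union> ?Q" for x
    using that self by (cases "g x = p \<or> g x = q") (auto simp: g'_def intro: orbit.intros)
  have "q \<in> ?Y"
  proof (rule ccontr)
    assume q: "q \<notin> ?Y"
    have "?P \<subseteq> ?P \<inter> ?Y"
    proof (rule orbit_subset_closed)
      fix x assume x: "x \<in> ?P \<inter> ?Y"
      then have "g x \<in> ?P" "g' x \<in> ?Y" by (auto intro: orbit.intros)
      moreover from this have "g x \<noteq> q" "g x \<noteq> p"
        using q self disj by (auto simp: g'_def)
      ultimately show "g x \<in> ?P \<inter> ?Y" using step by auto
    qed (use self in auto)
    moreover obtain x where "x \<in> ?P" "g x = p"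
    proof
      show "inv g p \<in> ?P"
        using orbit.base [of "inv g" p] by (simp add: orbit_inv_eq [OF g])
      show "g (inv g p) = p"
        using permutation_bijective [OF g] by (simp add: bij_is_surj surj_f_inv_f)
    qed
    ultimately have "g' x \<in> ?Y" by (auto intro: orbit.intros)
    then show False using q \<open>g x = p\<close> by (simp add: g'_def)
  qed
  then have closed: "g x \<in> ?Y" if "x \<in> ?Y" for x
    using step [of x] orbit.step [OF that] self \<open>q \<in> ?Y\<close> by fastforce
  have "?Y \<subseteq> ?P \<union> ?Q"
    using g'_cases self by (intro orbit_subset_closed) auto
  moreover have "?P \<subseteq> ?Y"
    using self(3) closed by (rule orbit_subset_closed)
  moreover have "?Q \<subseteq> ?Y"
    using \<open>q \<in> ?Y\<close> closed by (rule orbit_subset_closed)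
  ultimately show ?thesis by blast
qed

text \<open>
  The orbit of \<open>p\<close> is cut just before \<open>q\<close>: its initial segment \<open>T\<close> is closed under the new
  permutation.
\<close>

lemma orbit_split:
  assumes g: "permutation g" and q: "q \<in> orbit g p" "q \<noteq> p"
  shows "q \<notin> orbit (transpose p q \<circ> g) p"
proof -
  define m where "m = funpow_dist g p q"
  define T where "T = (\<lambda>i. (g ^^ i) p) ` {..<m}"
  have m: "(g ^^ m) p = q"
    unfolding m_def by (rule funpow_dist_prop [OF q(1)])
  have least: "(g ^^ i) p \<noteq> q" if "i < m" for i
    using that funpow_dist_least unfolding m_def by metis
  have "0 < m" using m q(2) by (cases m) auto
  have "orbit (transpose p q \<circ> g) p \<subseteq> T"
  proof (rule orbit_subset_closed)
    show "p \<in> T" using \<open>0 < m\<close> by (auto simp: T_def image_iff intro!: bexI [of _ 0])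
    fix y assume "y \<in> T"
    then obtain i where i: "i < m" "y = (g ^^ i) p" by (auto simp: T_def)
    then have gy: "g y = (g ^^ Suc i) p" by simp
    show "(transpose p q \<circ> g) y \<in> T"
    proof (cases "Suc i = m")
      case True
      then show ?thesis using gy m \<open>p \<in> T\<close> by simp
    next
      case False
      then have "Suc i < m" using i by simp
      moreover have "g y \<noteq> p"
      proof
        assume "g y = p"
        then have "(g ^^ (m - Suc i)) p = (g ^^ (m - Suc i + Suc i)) p"
          using gy by (simp only: funpow_add comp_apply)
        also have "\<dots> = q" using m \<open>Suc i < m\<close> by simp
        finally show False using least [of "m - Suc i"] i by simp
      qed
      ultimately show ?thesis
        using gy least [of "Suc i"] by (auto simp: T_def image_iff intro!: bexI [of _ "Suc i"])
    qed
  qed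
  moreover have "q \<notin> T" using least by (auto simp: T_def)
  ultimately show ?thesis by blast
qed

definition null_orbits :: "('a \<Rightarrow> 'a) \<Rightarrow> 'a set \<Rightarrow> ('a \<Rightarrow> 'g::ab_group_add) \<Rightarrow> nat" where
  "null_orbits g X t = card {C \<in> orbit g ` X. sum t C = 0}"

text \<open>
  The permutation models a system of closed loops, and \<open>t x\<close> is the value of some homomorphism on
  the piece of a loop from \<open>x\<close> to \<open>g x\<close>. The two pieces that end in \<open>p\<close> and \<open>q\<close> exchange their
  ends; their values may change as long as their total does not.
\<close>

definition reconnects ::
    "'a set \<Rightarrow> 'a \<Rightarrow> 'a \<Rightarrow> ('a \<Rightarrow> 'a) \<Rightarrow> ('a \<Rightarrow> 'g) \<Rightarrow> ('a \<Rightarrow> 'a) \<Rightarrow> ('a \<Rightarrow> 'g::ab_group_add) \<Rightarrow> bool"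
  where
  "reconnects X p q g t g' t' \<longleftrightarrow>
     finite X \<and> g permutes X \<and> p \<in> X \<and> q \<in> X \<and> p \<noteq> q \<and> g' = transpose p q \<circ> g \<and>
     (\<forall>x\<in>X. g x \<noteq> p \<longrightarrow> g x \<noteq> q \<longrightarrow> t' x = t x) \<and>
     t' (inv g p) + t' (inv g q) = t (inv g p) + t (inv g q)"

lemma reconnects_sym:
  assumes "reconnects X p q g t g' t'"
  shows "reconnects X p q g' t' g t"
proof -
  have g: "g permutes X" and g': "g' = transpose p q \<circ> g"
    using assms by (auto simp: reconnects_def)
  have "bij g" using g by (rule permutes_bij)
  then have "inv g' = inv g \<circ> transpose p q"
    unfolding g' by (subst o_inv_distrib) auto
  moreover have "g' permutes X"
    unfolding g' using assms by (intro permutes_compose g permutes_swap_id) (auto simp: reconnects_def)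
  ultimately show ?thesis
    using assms
    by (auto simp: reconnects_def fun_eq_iff add.commute transpose_eq_iff transpose_def split: if_splits)
qed

text \<open>
  Apart from the two orbits that merge, the orbits and their sums are the same before and after;
  \<open>r\<close> counts the null ones among these.
\<close>

lemma null_orbits_merge:
  fixes t :: "'a \<Rightarrow> 'g::ab_group_add"
  assumes re: "reconnects X p q g t g' t'" and q: "q \<notin> orbit g p"
  obtains r where
    "null_orbits g X t = r + of_bool (sum t (orbit g p) = 0) + of_bool (sum t (orbit g q) = 0)"
    "null_orbits g' X t' = r + of_bool (sum t (orbit g p) + sum t (orbit g q) = 0)"
    "sum t' (orbit g' p) = sum t (orbit g p) + sum t (orbit g q)"
proof -
  let ?P = "orbit g p" and ?Q = "orbit g q"
  have fin: "finite X" and g: "g permutes X" and pq: "p \<in> X" "q \<in> X" "p \<noteq> q"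
    and g': "g' = transpose p q \<circ> g"
    and t': "\<And>x. x \<in> X \<Longrightarrow> g x \<noteq> p \<Longrightarrow> g x \<noteq> q \<Longrightarrow> t' x = t x"
    and t'pq: "t' (inv g p) + t' (inv g q) = t (inv g p) + t (inv g q)"
    using re by (auto simp: reconnects_def)
  have perm: "permutation g" "permutation g'"
    using fin g reconnects_sym [OF re] by (auto simp: permutation_permutes reconnects_def)
  have self: "x \<in> orbit g x" "x \<in> orbit g' x" for x
    using perm by (simp_all add: permutation_self_in_orbit)
  have sub: "orbit g x \<subseteq> X" if "x \<in> X" for x
    using permutes_orbit_subset [OF g that] .
  have finorb: "finite (orbit g x)" if "x \<in> X" for x
    using finite_subset [OF sub fin] that .
  have disj: "?P \<inter> ?Q = {}"
    using orbit_eq_if_mem [OF perm(1)] self q by blast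
  have P': "orbit g' p = ?P \<union> ?Q"
    unfolding g' by (rule orbit_merge [OF perm(1) q])
  define R where "R = {C \<in> orbit g ` X. C \<noteq> ?P \<and> C \<noteq> ?Q}"
  have R_avoid: "p \<notin> C" "q \<notin> C" if "C \<in> R" for C
    using that orbit_eq_if_mem [OF perm(1)] by (auto simp: R_def)
  have orbits: "orbit g ` X = insert ?P (insert ?Q R)"
    using pq by (auto simp: R_def)
  have other: "orbit g' x = orbit g x" if "orbit g x \<in> R" for x
  proof (rule orbit_cong [OF self(1)])
    fix s assume "s \<in> orbit g x"
    then have "g s \<in> orbit g x" by (rule orbit.step)
    then have "g s \<noteq> p" "g s \<noteq> q" using R_avoid [OF that] by auto
    then show "g' s = g s" by (simp add: g')
  qed
  have orbits': "orbit g' ` X = insert (?P \<union> ?Q) R"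
  proof (intro equalityI subsetI)
    fix C assume "C \<in> orbit g' ` X"
    then obtain x where x: "x \<in> X" "C = orbit g' x" by auto
    show "C \<in> insert (?P \<union> ?Q) R"
    proof (cases "orbit g x \<in> R")
      case True
      then show ?thesis using x other by simp
    next
      case False
      then have "x \<in> ?P \<union> ?Q" using x self(1) [of x] by (auto simp: R_def)
      then have "C = ?P \<union> ?Q" using orbit_eq_if_mem [OF perm(2), of x p] x P' by simp
      then show ?thesis by simp
    qed
  next
    fix C assume "C \<in> insert (?P \<union> ?Q) R"
    then consider "C = orbit g' p" | "C \<in> R" using P' by auto
    then show "C \<in> orbit g' ` X"
    proof cases
      case 1
      then show ?thesis using pq by blast
    next
      case 2
      then obtain x where "x \<in> X" "C = orbit g x" by (auto simp: R_def)
      then show ?thesis using other [of x] 2 by blast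
    qed
  qed
  have sums_R: "sum t' C = sum t C" if "C \<in> R" for C
  proof (rule sum.cong [OF refl])
    from that obtain x where x: "x \<in> X" "C = orbit g x" by (auto simp: R_def)
    fix y assume y: "y \<in> C"
    then have "g y \<in> C" unfolding x by (rule orbit.step)
    then show "t' y = t y"
      using R_avoid [OF that] sub [OF x(1)] x y by (auto intro!: t')
  qed
  have "sum t' (?P \<union> ?Q) = sum t (?P \<union> ?Q)"
  proof -
    let ?x = "inv g p" and ?y = "inv g q"
    have inv: "g ?x = p" "g ?y = q" using permutes_inverses [OF g] by auto
    have inv_mem: "?x \<in> ?P" "?y \<in> ?Q"
      using self(1) orbit_inv_eq [OF perm(1)] orbit.base by metis+
    have split: "sum f (?P \<union> ?Q) = f ?x + f ?y + sum f (?P \<union> ?Q - {?x, ?y})" for f :: "'a \<Rightarrow> 'g"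
    proof -
      have "?x \<noteq> ?y" using inv pq by metis
      then have "f ?x + f ?y = sum f {?x, ?y}" by simp
      then show ?thesis
        using sum.subset_diff [of "{?x, ?y}" "?P \<union> ?Q" f] inv_mem finorb pq
        by (simp add: add.commute)
    qed
    have "sum t' (?P \<union> ?Q - {?x, ?y}) = sum t (?P \<union> ?Q - {?x, ?y})"
    proof (rule sum.cong [OF refl])
      fix z assume z: "z \<in> ?P \<union> ?Q - {?x, ?y}"
      then have "z \<in> X" using sub pq by auto
      moreover have "g z \<noteq> p" "g z \<noteq> q"
        using z permutes_inverses [OF g] by auto
      ultimately show "t' z = t z" by (rule t')
    qed
    then show ?thesis by (simp add: split t'pq)
  qed
  also have "\<dots> = sum t ?P + sum t ?Q"
    using finorb pq disj by (intro sum.union_disjoint) auto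
  finally have sum_PQ: "sum t' (?P \<union> ?Q) = sum t ?P + sum t ?Q" .
  let ?r = "{C \<in> R. sum t C = 0}"
  have finr: "finite ?r" using fin by (simp add: R_def)
  have ne: "?P \<noteq> ?Q" using disj self by blast
  have "{C \<in> orbit g ` X. sum t C = 0}
      = ?r \<union> ((if sum t ?P = 0 then {?P} else {}) \<union> (if sum t ?Q = 0 then {?Q} else {}))"
    unfolding orbits by auto
  then have 1: "null_orbits g X t = card ?r + of_bool (sum t ?P = 0) + of_bool (sum t ?Q = 0)"
    using finr ne unfolding null_orbits_def by (auto simp: R_def)
  have "?P \<union> ?Q \<notin> R" using R_avoid [of "?P \<union> ?Q"] self by blast
  moreover have "{C \<in> orbit g' ` X. sum t' C = 0}
      = ?r \<union> (if sum t ?P + sum t ?Q = 0 then {?P \<union> ?Q} else {})"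
    unfolding orbits' using sums_R sum_PQ by auto
  ultimately have 2: "null_orbits g' X t' = card ?r + of_bool (sum t ?P + sum t ?Q = 0)"
    using finr unfolding null_orbits_def by auto
  from 1 2 sum_PQ show thesis unfolding P' [symmetric] by (rule that)
qed

text \<open>
  A reconnection merges two orbits or splits one, and a split is a merge read backwards. The
  numbers could differ by 2 only if two null orbits merged to one that is not null, but the sums
  add up.
\<close>

lemma null_orbits_reconnect:
  assumes "reconnects X p q g t g' t'"
  shows "null_orbits g' X t' \<le> null_orbits g X t + 1"
    "null_orbits g X t \<le> null_orbits g' X t' + 1"
proof -
  have "null_orbits g' X t' \<le> null_orbits g X t + 1 \<and> null_orbits g X t \<le> null_orbits g' X t' + 1"
  proof (cases "q \<in> orbit g p")
    case False
    then obtain r where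
      "null_orbits g X t = r + of_bool (sum t (orbit g p) = 0) + of_bool (sum t (orbit g q) = 0)"
      "null_orbits g' X t' = r + of_bool (sum t (orbit g p) + sum t (orbit g q) = 0)"
      using null_orbits_merge [OF assms] by blast
    then show ?thesis by (auto simp: of_bool_def)
  next
    case True
    have "q \<notin> orbit g' p"
      using orbit_split [of g q p] True assms by (auto simp: reconnects_def permutation_permutes)
    then obtain r where
      "null_orbits g' X t' = r + of_bool (sum t' (orbit g' p) = 0) + of_bool (sum t' (orbit g' q) = 0)"
      "null_orbits g X t = r + of_bool (sum t' (orbit g' p) + sum t' (orbit g' q) = 0)"
      using null_orbits_merge [OF reconnects_sym [OF assms]] by blast
    then show ?thesis by (auto simp: of_bool_def)
  qed
  then show "null_orbits g' X t' \<le> null_orbits g X t + 1"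
    "null_orbits g X t \<le> null_orbits g' X t' + 1" by auto
qed

text \<open>
  With all values zero every orbit is null, so this is another instance of the count for merging
  orbits.
\<close>

lemma card_orbits_reconnect_parity:
  assumes "reconnects X p q g t g' t'"
  shows "even (card (orbit g' ` X)) \<longleftrightarrow> odd (card (orbit g ` X))"
proof -
  let ?z = "\<lambda>_. 0 :: int"
  have count: "card (orbit f ` X) = null_orbits f X ?z" for f :: "'a \<Rightarrow> 'a"
    by (simp add: null_orbits_def)
  have re: "reconnects X p q g ?z g' ?z"
    using assms by (simp add: reconnects_def)
  show ?thesis
  proof (cases "q \<in> orbit g p")
    case False
    then obtain r where "null_orbits g X ?z = r + 2" "null_orbits g' X ?z = r + 1"
      using null_orbits_merge [OF re] by auto
    then show ?thesis by (simp add: count)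
  next
    case True
    have "q \<notin> orbit g' p"
      using orbit_split [of g q p] True assms by (auto simp: reconnects_def permutation_permutes)
    then obtain r where "null_orbits g' X ?z = r + 2" "null_orbits g X ?z = r + 1"
      using null_orbits_merge [OF reconnects_sym [OF re]] by auto
    then show ?thesis by (simp add: count)
  qed
qed

lemma sum_orbit_gradient:
  fixes u :: "'a \<Rightarrow> 'g::ab_group_add"
  assumes "permutation g"
  shows "(\<Sum>x\<in>orbit g y. u (g x) - u x) = 0"
proof -
  have "g ` orbit g y = orbit g (g y)"
    by (rule orbit_inverse [of y g g g]) (auto simp: assms permutation_self_in_orbit)
  also have "\<dots> = orbit g y" using assms by (rule permutation_orbit_step)
  finally have "g ` orbit g y = orbit g y" .
  moreover have "inj_on g (orbit g y)"
    using assms by (metis inj_on_subset permutation_bijective bij_is_inj subset_UNIV)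
  ultimately have "(\<Sum>x\<in>orbit g y. u (g x)) = sum u (orbit g y)"
    using sum.reindex [of g "orbit g y" u] by simp
  then show ?thesis by (simp add: sum_subtractf)
qed

text \<open>
  The values \<open>t\<close> form the gradient of a potential \<open>u\<close>, so every orbit is null. A merge therefore
  turns two null orbits into one. After a split, the new values on the part that contains \<open>p\<close> are
  still the gradient of \<open>u\<close>, except on the one piece that was redirected to \<open>p\<close>; the sum is the
  defect there, and the last hypothesis keeps it nonzero. The other part has the opposite sum.
\<close>

lemma null_orbits_first_reconnect:
  fixes t :: "'a \<Rightarrow> 'g::ab_group_add"
  assumes re: "reconnects X p q g t g' t'"
    and t: "\<And>x. x \<in> X \<Longrightarrow> t x = u (g x) - u x"
    and ne: "q \<in> orbit g p \<Longrightarrow> t' (inv g q) \<noteq> u p - u (inv g q)"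
  shows "null_orbits g X t = null_orbits g' X t' + 1"
proof -
  have fin: "finite X" and g: "g permutes X" and pq: "p \<in> X" "q \<in> X" "p \<noteq> q"
    and g': "g' = transpose p q \<circ> g"
    and t': "\<And>x. x \<in> X \<Longrightarrow> g x \<noteq> p \<Longrightarrow> g x \<noteq> q \<Longrightarrow> t' x = t x"
    using re by (auto simp: reconnects_def)
  have g'X: "g' permutes X" using reconnects_sym [OF re] by (simp add: reconnects_def)
  have perm: "permutation g" "permutation g'"
    using fin g g'X by (auto simp: permutation_permutes)
  have null: "sum t (orbit g x) = 0" if "x \<in> X" for x
  proof -
    have "sum t (orbit g x) = (\<Sum>x\<in>orbit g x. u (g x) - u x)"
      using permutes_orbit_subset [OF g that] by (intro sum.cong) (auto simp: t)
    then show ?thesis by (simp add: sum_orbit_gradient [OF perm(1)])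
  qed
  show ?thesis
  proof (cases "q \<in> orbit g p")
    case False
    then obtain r where "null_orbits g X t = r + 2" "null_orbits g' X t' = r + 1"
      using null_orbits_merge [OF re] null pq by auto
    then show ?thesis by simp
  next
    case True
    let ?y = "inv g q"
    let ?P = "orbit g' p"
    have q: "q \<notin> ?P"
      unfolding g' by (rule orbit_split [OF perm(1) True]) (use pq in auto)
    have P: "?P \<subseteq> X" by (rule permutes_orbit_subset [OF g'X pq(1)])
    have y: "g ?y = q" "g' ?y = p"
      using permutes_inverses [OF g] by (auto simp: g')
    have "orbit g' ?y = ?P"
      using permutation_orbit_step [OF perm(2), of ?y] y by simp
    then have yP: "?y \<in> ?P"
      using permutation_self_in_orbit [OF perm(2), of ?y] by simp
    have "t' x - (u (g' x) - u x) = (if x = ?y then t' ?y - (u p - u ?y) else 0)" if "x \<in> ?P" for x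
    proof (cases "x = ?y")
      case True
      then show ?thesis using y by simp
    next
      case False
      have "g x \<noteq> q" using False permutes_inverses [OF g] by auto
      moreover have "g x \<noteq> p"
      proof
        assume "g x = p"
        then have "g' x = q" by (simp add: g')
        then show False using orbit.step [OF that] q by auto
      qed
      ultimately show ?thesis
        using t' [of x] t [of x] that P False by (auto simp: g')
    qed
    then have "(\<Sum>x\<in>?P. t' x - (u (g' x) - u x)) = t' ?y - (u p - u ?y)"
      using yP finite_subset [OF P fin] by (simp add: sum.delta cong: sum.cong)
    then have "sum t' ?P = t' ?y - (u p - u ?y)"
      unfolding sum_subtractf [of t'] sum_orbit_gradient [OF perm(2)] by simp
    then have P_ne: "sum t' ?P \<noteq> 0" using ne [OF True] by simp
    obtain r where r:
      "null_orbits g' X t' = r + of_bool (sum t' ?P = 0) + of_bool (sum t' (orbit g' q) = 0)"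
      "null_orbits g X t = r + of_bool (sum t' ?P + sum t' (orbit g' q) = 0)"
      "sum t (orbit g p) = sum t' ?P + sum t' (orbit g' q)"
      using null_orbits_merge [OF reconnects_sym [OF re] q] by blast
    have sum: "sum t' ?P + sum t' (orbit g' q) = 0"
      using r(3) null pq by simp
    then have "sum t' (orbit g' q) \<noteq> 0" using P_ne by auto
    then show ?thesis using r P_ne sum by simp
  qed
qed


section \<open>Degrees of \<open>A\<close>\<close>

lemma A_degrees_add: "A_degrees (p + q) \<subseteq> A_degrees p \<union> A_degrees q"
proof (transfer)
  fix p q :: "'a pre_ring"
  have "set_X0 (p + q) = set_X0 p + set_X0 q"
    by (simp add: set_X0_def frag_extend_add)
  then show "fst ` Poly_Mapping.keys (set_X0 (p + q)) \<subseteq>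
      fst ` Poly_Mapping.keys (set_X0 p) \<union> fst ` Poly_Mapping.keys (set_X0 q)"
    using keys_add [of "set_X0 p" "set_X0 q"] by auto
qed

lemma A_degrees_uminus: "A_degrees (- p) = A_degrees p"
proof (transfer)
  fix p :: "'a pre_ring"
  have "set_X0 (- p) = - set_X0 p"
    by (simp add: set_X0_def frag_extend_minus)
  then show "fst ` Poly_Mapping.keys (set_X0 (- p)) = fst ` Poly_Mapping.keys (set_X0 p)"
    by (simp add: keys_minus)
qed

text \<open>
  Substituting 1 for \<open>X\<^sub>0\<close> can only cancel monomials, so degrees can be bounded on any
  representative of a residue class.
\<close>

lemma fst_keys_set_X0: "fst ` Poly_Mapping.keys (set_X0 p) \<subseteq> fst ` Poly_Mapping.keys p"
proof
  fix k assume "k \<in> fst ` Poly_Mapping.keys (set_X0 p)"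
  then obtain y where y: "y \<in> Poly_Mapping.keys (set_X0 p)" "k = fst y" by blast
  then obtain n m where nm: "(n, m) \<in> Poly_Mapping.keys p"
    "y \<in> Poly_Mapping.keys (frag_of (n, Poly_Mapping.update (abs_upto_sign 0) 0 m))"
    using keys_frag_extend unfolding set_X0_def by fastforce
  then show "k \<in> fst ` Poly_Mapping.keys p"
    using y by force
qed

lemma A_degrees_mult: "A_degrees (p * q) \<subseteq> {m + n | m n. m \<in> A_degrees p \<and> n \<in> A_degrees q}"
proof (transfer)
  fix p q :: "'a pre_ring"
  let ?p = "set_X0 p" and ?q = "set_X0 q"
  have "X0_minus_1 dvd (p - ?p) * q + ?p * (q - ?q)"
    using set_X0_rep [of p] set_X0_rep [of q]
    unfolding ideal_cong_def by (intro dvd_add dvd_mult dvd_mult2)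
  then have "ideal_cong (p * q) (?p * ?q)"
    by (simp add: ideal_cong_def algebra_simps)
  then have "fst ` Poly_Mapping.keys (set_X0 (p * q)) \<subseteq> fst ` Poly_Mapping.keys (?p * ?q)"
    using fst_keys_set_X0 [of "?p * ?q"] by (simp add: set_X0_cong)
  also have "\<dots> \<subseteq> fst ` {a + b | a b. a \<in> Poly_Mapping.keys ?p \<and> b \<in> Poly_Mapping.keys ?q}"
    by (intro image_mono keys_mult)
  also have "\<dots> \<subseteq> {m + n | m n. m \<in> fst ` Poly_Mapping.keys ?p \<and> n \<in> fst ` Poly_Mapping.keys ?q}"
  proof
    fix k assume "k \<in> fst ` {a + b | a b. a \<in> Poly_Mapping.keys ?p \<and> b \<in> Poly_Mapping.keys ?q}"
    then obtain a b where "k = fst (a + b)" "a \<in> Poly_Mapping.keys ?p" "b \<in> Poly_Mapping.keys ?q"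
      by blast
    then have "k = fst a + fst b" "fst a \<in> fst ` Poly_Mapping.keys ?p" "fst b \<in> fst ` Poly_Mapping.keys ?q"
      by (simp_all add: plus_prod_def)
    then show "k \<in> {m + n | m n. m \<in> fst ` Poly_Mapping.keys ?p \<and> n \<in> fst ` Poly_Mapping.keys ?q}"
      by blast
  qed
  finally show "fst ` Poly_Mapping.keys (set_X0 (p * q)) \<subseteq>
      {m + n | m n. m \<in> fst ` Poly_Mapping.keys ?p \<and> n \<in> fst ` Poly_Mapping.keys ?q}" .
qed

text \<open>
  The factor \<open>d\<close> is \<open>1\<close> for upper and \<open>-1\<close> for lower bounds of the degrees, so that both ends of
  the polynomial are treated by the same lemmas.
\<close>

definition degree_le :: "int \<Rightarrow> int \<Rightarrow> 'g::ab_group_add R_ring \<Rightarrow> bool" where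
  "degree_le d b p \<longleftrightarrow> (\<forall>n \<in> A_degrees p. d * n \<le> b)"

lemma degree_le_mono: "degree_le d b p \<Longrightarrow> b \<le> b' \<Longrightarrow> degree_le d b' p"
  by (force simp: degree_le_def)

lemma degree_le_zero: "degree_le d b 0"
  unfolding degree_le_def by transfer (simp add: set_X0_def)

lemma degree_le_add: "degree_le d b p \<Longrightarrow> degree_le d b q \<Longrightarrow> degree_le d b (p + q)"
  using A_degrees_add [of p q] by (auto simp: degree_le_def)

lemma degree_le_uminus: "degree_le d b p \<Longrightarrow> degree_le d b (- p)"
  by (simp add: degree_le_def A_degrees_uminus)

lemma degree_le_mult:
  assumes "degree_le d b p" "degree_le d b' q"
  shows "degree_le d (b + b') (p * q)"
  unfolding degree_le_def
proof
  fix k assume "k \<in> A_degrees (p * q)"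
  then obtain m n where "k = m + n" "m \<in> A_degrees p" "n \<in> A_degrees q"
    using A_degrees_mult [of p q] by auto
  then show "d * k \<le> b + b'"
    using assms by (auto simp: degree_le_def distrib_left intro: add_mono)
qed

lemma degree_le_sum:
  "(\<And>i. i \<in> I \<Longrightarrow> degree_le d b (f i)) \<Longrightarrow> degree_le d b (\<Sum>i\<in>I. f i)"
  by (induction I rule: infinite_finite_induct)
     (auto simp: degree_le_zero intro: degree_le_add)

lemma A_power_zero: "A_power 0 = 1"
  by transfer (simp add: pre_A_def ideal_cong_def zero_prod_def [symmetric])

lemma A_power_add: "A_power (m + n) = A_power m * A_power n"
  by transfer (simp add: pre_A_def ideal_cong_def mult_single)

lemma set_X0_pre_A: "set_X0 (pre_A n :: 'g::ab_group_add pre_ring) = pre_A n"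
proof -
  have "Poly_Mapping.update (abs_upto_sign 0) 0 0 = (0 :: 'g upto_sign \<Rightarrow>\<^sub>0 nat)"
    by (rule poly_mapping_eqI) (simp add: lookup_update)
  then show ?thesis by (simp add: set_X0_def pre_A_def)
qed

lemma degree_le_A_power: "degree_le d (d * n) (A_power n)"
  unfolding degree_le_def by transfer (simp add: set_X0_pre_A, simp add: pre_A_def)

lemma degree_le_one: "degree_le d 0 1"
  using degree_le_A_power [of d 0] by (simp add: A_power_zero)

lemma degree_le_prod_X_var: "degree_le d 0 (\<Prod>i\<in>I. X_var (f i))"
proof (induction I rule: infinite_finite_induct)
  case (insert i I)
  have "degree_le d 0 (X_var (f i))"
    unfolding degree_le_def
  proof transfer
    fix d f i
    show "\<forall>n\<in>fst ` Poly_Mapping.keys (set_X0 (pre_X (abs_upto_sign (f i)))). d * n \<le> 0"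
      using fst_keys_set_X0 [of "pre_X (abs_upto_sign (f i))"] by (auto simp: pre_X_def)
  qed
  from degree_le_mult [OF this insert.IH] insert.hyps show ?case by simp
qed (simp_all add: degree_le_one)

text \<open>
  Up to sign, \<open>A\<^sup>n\<close> is the only term of extreme degree in the direction \<open>d\<close>; in particular this
  term contains no \<open>X\<close> variable.
\<close>

definition extreme_term :: "int \<Rightarrow> int \<Rightarrow> 'g::ab_group_add R_ring \<Rightarrow> bool" where
  "extreme_term d n p \<longleftrightarrow>
     (\<exists>e r. (e = 1 \<or> e = - 1) \<and> p = e * A_power n + r \<and> degree_le d (d * n - 1) r)"

lemma extreme_termI:
  "p = e * A_power n + r \<Longrightarrow> e = 1 \<or> e = - 1 \<Longrightarrow> degree_le d (d * n - 1) r \<Longrightarrow> extreme_term d n p"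
  by (auto simp: extreme_term_def)

lemma degree_le_sign: "e = 1 \<or> e = - 1 \<Longrightarrow> degree_le d b p \<Longrightarrow> degree_le d b (e * p)"
  by (auto intro: degree_le_uminus)

lemma extreme_term_add:
  assumes "extreme_term d n p" "degree_le d (d * n - 1) q"
  shows "extreme_term d n (p + q)"
proof -
  from assms(1) obtain e r where "e = 1 \<or> e = - 1" "p = e * A_power n + r" "degree_le d (d * n - 1) r"
    by (auto simp: extreme_term_def)
  then show ?thesis
    using degree_le_add [OF _ assms(2), of r] by (intro extreme_termI [of _ e _ "r + q"]) simp_all
qed

lemma extreme_term_mult:
  assumes "extreme_term d m p" "extreme_term d n q"
  shows "extreme_term d (m + n) (p * q)"
proof -
  from assms(1) obtain e r where e: "e = 1 \<or> e = - 1" and p: "p = e * A_power m + r"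
    and r: "degree_le d (d * m - 1) r"
    by (auto simp: extreme_term_def)
  from assms(2) obtain e' r' where e': "e' = 1 \<or> e' = - 1" and q: "q = e' * A_power n + r'"
    and r': "degree_le d (d * n - 1) r'"
    by (auto simp: extreme_term_def)
  have "degree_le d (d * m + (d * n - 1)) (e * A_power m * r')"
    using e by (intro degree_le_mult degree_le_sign degree_le_A_power r')
  moreover have "degree_le d (d * m - 1 + d * n) (r * (e' * A_power n))"
    using e' by (intro degree_le_mult degree_le_sign degree_le_A_power r)
  moreover have "degree_le d (d * m - 1 + (d * n - 1)) (r * r')"
    by (intro degree_le_mult r r')
  ultimately have "degree_le d (d * (m + n) - 1)
      (e * A_power m * r' + (r * (e' * A_power n) + r * r'))"
    by (intro degree_le_add; elim degree_le_mono) (simp_all add: algebra_simps)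
  then show ?thesis
    using e e' by (intro extreme_termI [of _ "e * e'"]) (auto simp: p q A_power_add algebra_simps)
qed

lemma extreme_term_A_power: "extreme_term d n (A_power n)"
  by (rule extreme_termI [of _ 1 _ 0]) (simp_all add: degree_le_zero)

lemma extreme_term_power:
  "extreme_term d n p \<Longrightarrow> extreme_term d (int k * n) (p ^ k)"
proof (induction k)
  case 0
  then show ?case using extreme_term_A_power [of d 0] by (simp add: A_power_zero)
next
  case (Suc k)
  then show ?case
    using extreme_term_mult [of d n p "int k * n" "p ^ k"] by (simp add: algebra_simps)
qed

text \<open>
  The factor of a null loop has the extreme degrees 2 and -2, that is \<open>2 d\<close>.
\<close>

lemma extreme_term_loop_factor:
  assumes "d = 1 \<or> d = - 1"
  shows "extreme_term d (2 * d) (- A_power 2 - A_power (- 2))"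
proof (rule extreme_termI [of _ "- 1" _ "- A_power (- 2 * d)"])
  show "degree_le d (d * (2 * d) - 1) (- A_power (- 2 * d))"
    by (intro degree_le_uminus degree_le_mono [OF degree_le_A_power]) (use assms in auto)
qed (use assms in auto)

lemma extreme_term_degree_le:
  assumes "extreme_term d n p"
  shows "degree_le d (d * n) p"
proof -
  from assms obtain e r where "e = 1 \<or> e = - 1" "p = e * A_power n + r" "degree_le d (d * n - 1) r"
    by (auto simp: extreme_term_def)
  then show ?thesis
    using degree_le_mono [of d "d * n - 1" r "d * n"]
    by (auto intro!: degree_le_add degree_le_sign degree_le_A_power)
qed

lemma extreme_term_in_A_degrees:
  fixes p :: "'g::ab_group_add R_ring"
  assumes "extreme_term d n p"
  shows "n \<in> A_degrees p"
proof -
  \<comment> \<open>The coefficient at \<open>A\<^sup>n\<close> without \<open>X\<close> variables is 1, as \<open>r\<close> contributes nothing.\<close>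
  have lead: "n \<in> A_degrees (A_power n + r)" if "n \<notin> A_degrees r" for r :: "'g R_ring"
    using that
  proof transfer
    fix n :: int and r :: "'g pre_ring"
    assume n: "n \<notin> fst ` Poly_Mapping.keys (set_X0 r)"
    have "set_X0 (pre_A n + r) = pre_A n + set_X0 r"
      using set_X0_pre_A [of n] by (simp add: set_X0_def frag_extend_add)
    moreover have "Poly_Mapping.lookup (set_X0 r) (n, 0) = 0"
      using n by (force simp: in_keys_iff)
    ultimately have "(n, 0) \<in> Poly_Mapping.keys (set_X0 (pre_A n + r))"
      by (simp add: in_keys_iff lookup_add pre_A_def)
    then show "n \<in> fst ` Poly_Mapping.keys (set_X0 (pre_A n + r))" by force
  qed
  from assms obtain e r where e: "e = 1 \<or> e = - 1" and p: "p = e * A_power n + r"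
    and r: "degree_le d (d * n - 1) r"
    by (auto simp: extreme_term_def)
  from r have "n \<notin> A_degrees r" by (auto simp: degree_le_def)
  then have "n \<in> A_degrees (A_power n + e * r)"
    using e lead [of r] lead [of "- r"] by (auto simp: A_degrees_uminus)
  moreover have "A_power n + e * r = e * p"
    using e p by auto
  ultimately show ?thesis
    using e by (auto simp: A_degrees_uminus)
qed

lemma breadth_A_eq:
  fixes p :: "'g::ab_group_add R_ring"
  assumes "extreme_term 1 u p" "extreme_term (- 1) l p"
  shows "p \<noteq> 0 \<and> breadth_A p = u - l"
proof -
  have "A_degrees (0 :: 'g R_ring) = {}" by transfer (simp add: set_X0_def)
  then have "p \<noteq> 0" using extreme_term_in_A_degrees [OF assms(1)] by auto
  have sub: "A_degrees p \<subseteq> {l..u}"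
    using assms [THEN extreme_term_degree_le] by (auto simp: degree_le_def)
  then have "finite (A_degrees p)" by (rule finite_subset) simp
  then have "Max (A_degrees p) = u" "Min (A_degrees p) = l"
    using sub assms [THEN extreme_term_in_A_degrees] by (auto intro!: Max_eqI Min_eqI)
  then show ?thesis using \<open>p \<noteq> 0\<close> by (simp add: breadth_A_def)
qed


section \<open>The homomorphism on chains\<close>

lemma int_mult_zero: "int_mult 0 g = 0"
  by (simp add: int_mult_def)

lemma int_mult_Suc: "int_mult (n + 1) g = int_mult n g + g"
proof (cases "n \<ge> 0")
  case True
  then have "nat (n + 1) = Suc (nat n)" by simp
  then show ?thesis using True by (simp add: int_mult_def)
next
  case False
  then have "nat (- n) = Suc (nat (- (n + 1)))" by simp
  then show ?thesis using False by (simp add: int_mult_def)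
qed

lemma int_mult_add: "int_mult (m + n) g = int_mult m g + int_mult n g"
proof (induction n rule: int_induct [where k = 0])
  case base
  then show ?case by (simp add: int_mult_zero)
next
  case (step1 i)
  then show ?case using int_mult_Suc [of "m + i" g] int_mult_Suc [of i g] by (simp add: add.assoc)
next
  case (step2 i)
  then show ?case using int_mult_Suc [of "m + (i - 1)" g] int_mult_Suc [of "i - 1" g]
    by (simp add: algebra_simps)
qed

text \<open>
  The homomorphism \<open>h_map\<close> extends to all 1-chains, since the intersection with a component of the
  link is given by a sum over its edges. The values on the arcs of a loop can then be computed
  separately. The value \<open>edge_value D lab h\<close> below is the label of the link component along \<open>h\<close>,
  with a sign for the orientation.
\<close>

definition chain_value ::
    "('h, 'b) vdiagram_scheme \<Rightarrow> ('h set \<Rightarrow> 'g) \<Rightarrow> ('h \<Rightarrow> int) \<Rightarrow> 'g::ab_group_add" where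
  "chain_value D lab c = (\<Sum>K\<in>link_components D. int_mult (\<Sum>h\<in>K. c h) (lab K))"

lemma chain_value_zero: "chain_value D lab (\<lambda>_. 0) = 0"
  by (simp add: chain_value_def int_mult_zero)

lemma chain_value_add:
  "chain_value D lab (\<lambda>h. c h + c' h) = chain_value D lab c + chain_value D lab c'"
  by (simp add: chain_value_def sum.distrib int_mult_add)

lemma chain_value_sum:
  "chain_value D lab (\<lambda>h. \<Sum>x\<in>X. c x h) = (\<Sum>x\<in>X. chain_value D lab (c x))"
  by (induction X rule: infinite_finite_induct) (simp_all add: chain_value_zero chain_value_add)

definition edge_value ::
    "('h, 'b) vdiagram_scheme \<Rightarrow> ('h set \<Rightarrow> 'g) \<Rightarrow> 'h \<Rightarrow> 'g::ab_group_add" where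
  "edge_value D lab h = chain_value D lab (cross D h)"

lemma chain_value_turn:
  "chain_value D lab (turn D h) = edge_value D lab h + edge_value D lab (rot D h)"
proof -
  have "turn D h = (\<lambda>k. cross D h k + cross D (rot D h) k)" by (simp add: fun_eq_iff turn_def)
  then show ?thesis by (simp only: chain_value_add edge_value_def)
qed

lemma h_map_hclass:
  assumes "virtual_link_diagram D" "c \<in> cycles D"
  shows "h_map D lab (hclass D c) = chain_value D lab c"
  unfolding h_map_def chain_value_def
  by (rule sum.cong) (simp_all add: intersection_number_hclass assms)

lemma edge_value_opp:
  assumes "virtual_link_diagram D" "h \<in> half D"
  shows "edge_value D lab (opp D h) = - edge_value D lab h"
proof -
  have "(\<lambda>k. cross D h k + cross D (opp D h) k) = (\<lambda>_. 0)"
    using opp_opp [OF assms] by (simp add: cross_def fun_eq_iff)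
  then have "edge_value D lab h + edge_value D lab (opp D h) = 0"
    unfolding edge_value_def chain_value_add [symmetric] by (simp add: chain_value_zero)
  then show ?thesis by (simp add: eq_neg_iff_add_eq_0 add.commute)
qed

lemma vertex_of_eq:
  assumes "virtual_link_diagram D" "k \<in> vertex_of D h"
  shows "vertex_of D k = vertex_of D h"
  using orbit_eq_if_mem [OF rot_permutation [OF assms(1)]] assms(2) unfolding vertex_of_def by blast

lemma self_in_vertex_of:
  assumes "virtual_link_diagram D"
  shows "h \<in> vertex_of D h"
  using assms by (simp add: vertex_of_def permutation_self_in_orbit rot_permutation)

lemma vertex_of_subset:
  assumes "virtual_link_diagram D" "h \<in> half D"
  shows "vertex_of D h \<subseteq> half D"
  using permutes_orbit_subset [OF rot_permutes] assms by (simp add: vertex_of_def)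

text \<open>
  A small circle around a vertex bounds, so the homomorphism vanishes on it.
\<close>

lemma sum_edge_value_vertex:
  assumes D: "virtual_link_diagram D" and h: "h \<in> half D"
  shows "(\<Sum>x\<in>vertex_of D h. edge_value D lab x) = 0"
proof -
  let ?v = "vertex_of D h"
  have sub: "?v \<subseteq> half D" and fin: "finite ?v"
    using vertex_of_subset [OF D h] finite_half [OF D] by (auto intro: finite_subset)
  have "(\<Sum>x\<in>?v. cross D x k) = boundary D (\<lambda>v. of_bool (v = ?v)) k" for k
  proof (cases "k \<in> half D")
    case True
    have opp_eq: "k = opp D x \<longleftrightarrow> x = opp D k" if "x \<in> ?v" for x
      using opp_opp [OF D] True sub that by auto
    have mem: "y \<in> ?v \<longleftrightarrow> vertex_of D y = ?v" for y
      using vertex_of_eq [OF D, of y h] self_in_vertex_of [OF D, of y] by auto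
    have "(\<Sum>x\<in>?v. cross D x k)
        = (\<Sum>x\<in>?v. if x = k then 1 else 0) - (\<Sum>x\<in>?v. if x = opp D k then 1 else 0)"
      unfolding sum_subtractf [symmetric]
      by (rule sum.cong) (auto simp: cross_def opp_eq)
    also have "\<dots> = of_bool (k \<in> ?v) - of_bool (opp D k \<in> ?v)"
      using fin by simp
    finally show ?thesis using True by (simp add: boundary_def mem)
  next
    case False
    then have "cross D x k = 0" if "x \<in> ?v" for x
      using sub that opp_in_half [OF D, of x] by (auto simp: cross_def)
    then show ?thesis using False by (simp add: boundary_def)
  qed
  then have "(\<Sum>x\<in>?v. edge_value D lab x) = chain_value D lab (boundary D (\<lambda>v. of_bool (v = ?v)))"
    unfolding edge_value_def chain_value_sum [symmetric] by simp
  also have "\<dots> = 0"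
    by (simp add: chain_value_def sum_boundary_component [OF D] int_mult_zero)
  finally show ?thesis .
qed

lemma crossing_half_edges:
  assumes D: "virtual_link_diagram D" and h: "at_crossing D h"
  shows "vertex_of D h = {h, rot D h, rot D (rot D h), rot D (rot D (rot D h))}"
    and "rot D (rot D (rot D (rot D h))) = h"
    and "rot D (rot D h) \<noteq> h"
proof -
  let ?f = "\<lambda>n. (rot D ^^ n) h"
  have self: "h \<in> orbit (rot D) h"
    by (rule permutation_self_in_orbit [OF rot_permutation [OF D]])
  have orbit: "vertex_of D h = ?f ` {0..<funpow_dist1 (rot D) h h}"
    unfolding vertex_of_def by (rule orbit_conv_funpow_dist1 [OF self])
  have "card (?f ` {0..<funpow_dist1 (rot D) h h}) = funpow_dist1 (rot D) h h"
    using card_image [OF inj_on_funpow_dist1 [OF self]] by simp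
  then have four: "funpow_dist1 (rot D) h h = 4"
    using h unfolding orbit [symmetric] by (simp add: at_crossing_def)
  have "{0..<4} = {0, 1, 2, 3 :: nat}" by auto
  then show v: "vertex_of D h = {h, rot D h, rot D (rot D h), rot D (rot D (rot D h))}"
    unfolding orbit four by (simp add: numeral_eq_Suc)
  show "rot D (rot D (rot D (rot D h))) = h"
    using funpow_dist1_prop [OF self] unfolding four by (simp add: numeral_eq_Suc)
  show "rot D (rot D h) \<noteq> h"
  proof
    assume "rot D (rot D h) = h"
    then have "vertex_of D h = {h, rot D h}"
      unfolding v by auto
    then have "card (vertex_of D h) = card {h, rot D h}" by simp
    also have "\<dots> \<le> 2" by (rule card_insert_le_m1) auto
    finally show False using h by (simp add: at_crossing_def)
  qed
qed


section \<open>A growth bound for functions of subsets\<close>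

text \<open>
  A function of subsets that first drops by 1 and then grows by at most 1 with each element lies
  at least 2 below the bound \<open>F {} + card S\<close> that a growth by 1 in every step would give.
\<close>

lemma growth_bound_after_drop:
  fixes F :: "'a set \<Rightarrow> nat"
  assumes "finite V" "S \<subseteq> V" "S \<noteq> {}"
    and step: "\<And>S v. S \<subseteq> V \<Longrightarrow> v \<in> V \<Longrightarrow> v \<notin> S \<Longrightarrow> F (insert v S) \<le> F S + 1"
    and first: "\<And>v. v \<in> V \<Longrightarrow> F {v} + 1 \<le> F {}"
  shows "F S + 2 \<le> F {} + card S"
proof -
  have "finite S" using assms(1,2) by (rule rev_finite_subset)
  then show ?thesis using assms(3,2)
  proof (induction S rule: finite_ne_induct)
    case (singleton v)
    then show ?case using first [of v] by simp
  next
    case (insert v S)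
    then have "F (insert v S) \<le> F S + 1" using step [of S v] by simp
    then show ?case using insert by simp
  qed
qed


section \<open>Loops of an alternating diagram as orbits on the over half-edges\<close>

text \<open>
  By connectedness, the only diagram of the theorem outside this locale is a single circle without
  crossings.
\<close>

locale alternating_crossing_diagram =
  fixes D :: "('h, 'b) vdiagram_scheme"
  assumes D: "virtual_link_diagram D"
    and alternating: "alternating D"
    and all_crossings: "h \<in> half D \<Longrightarrow> at_crossing D h"
begin

lemmas rot_inv_simps [simp] = rot_inv [OF D]
lemmas half_simps [simp] = rot_in_half [OF D] opp_in_half [OF D] inv_rot_in_half [OF D]
lemmas vertex_simps [simp] = vertex_of_rot [OF D] vertex_of_inv_rot [OF D]

lemma opp_opp_half [simp]: "h \<in> half D \<Longrightarrow> opp D (opp D h) = h"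
  by (rule opp_opp [OF D])

lemma over_half [simp]: "h \<in> over D \<Longrightarrow> h \<in> half D"
  using D by (auto simp: virtual_link_diagram_def at_crossing_def)

lemma finite_over: "finite (over D)"
  using finite_half [OF D] by (rule rev_finite_subset) auto

lemma over_opp [simp]: "h \<in> half D \<Longrightarrow> opp D h \<in> over D \<longleftrightarrow> h \<notin> over D"
  using alternating all_crossings by (auto simp: alternating_def)

lemma over_rot [simp]: "h \<in> half D \<Longrightarrow> rot D h \<in> over D \<longleftrightarrow> h \<notin> over D"
  using D all_crossings by (auto simp: virtual_link_diagram_def)

lemma over_inv_rot [simp]: "h \<in> half D \<Longrightarrow> inv (rot D) h \<in> over D \<longleftrightarrow> h \<notin> over D"
  using over_rot [of "inv (rot D) h"] by simp

lemma rot_neq_inv_rot: "h \<in> half D \<Longrightarrow> rot D h \<noteq> inv (rot D) h"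
  using crossing_half_edges(3) [OF D all_crossings, of h] by (metis rot_inv_simps(1))

lemma inv_rot_eq: "h \<in> half D \<Longrightarrow> inv (rot D) h = rot D (rot D (rot D h))"
  using crossing_half_edges(2) [OF D all_crossings, of h] by (metis rot_inv_simps(2))

text \<open>
  One step along a loop of the state, from the over half-edge along which it leaves a crossing to
  the one along which it leaves the next.
\<close>

definition trace :: "'h set set \<Rightarrow> 'h \<Rightarrow> 'h" where
  "trace S h = (if h \<in> over D then loop_next D S h else h)"

lemma trace_eq:
  "h \<in> over D \<Longrightarrow> trace S h =
     (if vertex_of D (opp D h) \<in> S then rot D (opp D h) else inv (rot D) (opp D h))"
  by (simp add: trace_def loop_next_def smoothing_def)

lemma trace_permutes: "trace S permutes over D"
proof (rule bij_imp_permutes)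
  have "inj_on (loop_next D S) (over D)"
    using loop_next_permutes_half [OF D, of S] by (auto simp: bij_betw_def intro: inj_on_subset)
  then have inj: "inj_on (trace S) (over D)"
    by (simp add: trace_def cong: inj_on_cong)
  moreover have "trace S ` over D \<subseteq> over D"
    by (auto simp: trace_eq)
  ultimately show "bij_betw (trace S) (over D) (over D)"
    using finite_over by (simp add: bij_betw_def endo_inj_surj)
qed (simp add: trace_def)

lemma permutation_trace: "permutation (trace S)"
  using trace_permutes finite_over by (auto simp: permutation_permutes)

lemma trace_in_over: "h \<in> over D \<Longrightarrow> trace S h \<in> over D"
  by (simp add: permutes_in_image [OF trace_permutes])

lemma directed_loop_over:
  assumes "h \<in> over D"
  shows "directed_loop D S h = orbit (trace S) h"
  unfolding directed_loop_def
  by (rule orbit_cong0 [symmetric, where A = "over D"])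
     (use assms in \<open>auto simp: trace_def [symmetric] trace_in_over\<close>, simp add: trace_def)

lemma orbit_trace_subset: "h \<in> over D \<Longrightarrow> orbit (trace S) h \<subseteq> over D"
  by (rule permutes_orbit_subset [OF trace_permutes])

lemma loop_next_permutation: "permutation (loop_next D S)"
proof -
  have "loop_next D S h = h" if "h \<notin> half D" for h
  proof -
    have "opp D h = h" "rot D h = h" "inv (rot D) h = h"
      using that permutes_not_in opp_permutes [OF D] rot_permutes [OF D] permutes_inv by metis+
    then show ?thesis by (simp add: loop_next_def smoothing_def)
  qed
  then have "loop_next D S permutes half D"
    using loop_next_permutes_half [OF D] by (intro bij_imp_permutes) auto
  then show ?thesis using finite_half [OF D] by (auto simp: permutation_permutes)
qed

text \<open>
  The step along a loop is the composition of the involutions \<open>opp\<close> and \<open>smoothing\<close>, so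
  conjugating it with \<open>opp\<close> inverts it.
\<close>

lemma directed_loop_reverse:
  assumes h: "h \<in> half D"
  shows "directed_loop D S (opp D h) = opp D ` directed_loop D S h"
proof -
  let ?f = "loop_next D S"
  have bij: "bij ?f" by (rule permutation_bijective [OF loop_next_permutation])
  have "opp D ` orbit ?f h = orbit (inv ?f) (opp D h)"
  proof (rule orbit_inverse)
    show "h \<in> orbit ?f h" by (rule permutation_self_in_orbit [OF loop_next_permutation])
    fix x assume "x \<in> orbit ?f h"
    then have x: "x \<in> half D"
      using directed_loop_props(1) [OF D h] by (auto simp: directed_loop_def)
    have "?f (opp D (?f x)) = opp D x"
      using x by (simp add: loop_next_def smoothing_in_half [OF D] smoothing_smoothing [OF D])
    then show "inv ?f (opp D x) = opp D (?f x)"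
      using bij by (metis bij_inv_eq_iff)
  qed
  then show ?thesis
    by (simp add: directed_loop_def orbit_inv_eq [OF loop_next_permutation])
qed

text \<open>
  The contribution of the arc from \<open>x\<close> to \<open>trace S x\<close> to the loop pushed off to its left: arriving
  along the under half-edge \<open>opp x\<close>, an \<open>A\<close>-smoothing turns right and a \<open>B\<close>-smoothing turns left.
\<close>

definition arc_value :: "('h set \<Rightarrow> 'g) \<Rightarrow> 'h set set \<Rightarrow> 'h \<Rightarrow> 'g::ab_group_add" where
  "arc_value lab S x =
     (if vertex_of D (opp D x) \<in> S
      then edge_value D lab (opp D x) + edge_value D lab (rot D (opp D x)) else 0)"

lemma chain_value_loop_cycle:
  "chain_value D lab (loop_cycle D S h) =
     (\<Sum>x \<in> opp D ` directed_loop D S h. if smoothing D S x = inv (rot D) x then 0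
        else edge_value D lab x + edge_value D lab (rot D x))"
proof -
  have "chain_value D lab (loop_cycle D S h) =
      (\<Sum>x \<in> opp D ` directed_loop D S h.
         chain_value D lab (\<lambda>k. if smoothing D S x = inv (rot D) x then 0 else turn D x k))"
    unfolding loop_cycle_def [abs_def] by (rule chain_value_sum)
  also have "\<dots> = (\<Sum>x \<in> opp D ` directed_loop D S h. if smoothing D S x = inv (rot D) x then 0
        else edge_value D lab x + edge_value D lab (rot D x))"
    by (rule sum.cong) (auto simp: chain_value_zero chain_value_turn)
  finally show ?thesis .
qed

lemma loop_cycle_over:
  assumes h: "h \<in> over D"
  shows "chain_value D lab (loop_cycle D S h) = sum (arc_value lab S) (orbit (trace S) h)"
proof -
  have inj: "inj_on (opp D) (orbit (trace S) h)"
    by (rule inj_on_subset [OF permutes_inj [OF opp_permutes [OF D]]]) simp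
  have "(if smoothing D S (opp D x) = inv (rot D) (opp D x) then 0
        else edge_value D lab (opp D x) + edge_value D lab (rot D (opp D x))) = arc_value lab S x"
    if "x \<in> orbit (trace S) h" for x
  proof -
    have "x \<in> over D" using orbit_trace_subset [OF h] that by auto
    then show ?thesis
      using rot_neq_inv_rot [of "opp D x"] by (simp add: smoothing_def arc_value_def)
  qed
  then show ?thesis
    unfolding chain_value_loop_cycle directed_loop_over [OF h] sum.reindex [OF inj] comp_def
    by (rule sum.cong [OF refl])
qed

text \<open>
  The same loop traversed backwards and pushed off to its left, hence to the right of the original
  direction. An arc contributes to the push-off on the side towards which it does not turn.
  Therefore the contributions of an arc to both push-offs add up to the difference of the edge
  values at its ends, and these differences cancel around the loop.
\<close>

lemma loop_cycle_reverse:
  assumes h: "h \<in> over D"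
  shows "chain_value D lab (loop_cycle D S (opp D h)) = - sum (arc_value lab S) (orbit (trace S) h)"
proof -
  let ?O = "orbit (trace S) h"
  let ?e = "edge_value D lab"
  define r where "r x = (if smoothing D S x = inv (rot D) x then 0 else ?e x + ?e (rot D x))" for x
  have O: "?O \<subseteq> over D" by (rule orbit_trace_subset [OF h])
  have "opp D ` directed_loop D S (opp D h) = (\<lambda>x. opp D (opp D x)) ` ?O"
    using h by (simp add: directed_loop_reverse directed_loop_over image_image)
  also have "\<dots> = id ` ?O"
    using O by (intro image_cong) (auto simp: subset_iff)
  finally have "chain_value D lab (loop_cycle D S (opp D h)) = sum r ?O"
    unfolding chain_value_loop_cycle by (simp add: r_def)
  moreover have "r (trace S x) + arc_value lab S x = ?e (trace S x) - ?e x" if "x \<in> ?O" for x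
  proof -
    have x: "x \<in> over D" using O that by auto
    then show ?thesis
      using rot_neq_inv_rot [of "inv (rot D) (opp D x)"]
      by (simp add: r_def smoothing_def arc_value_def trace_eq edge_value_opp [OF D])
  qed
  then have "(\<Sum>x\<in>?O. r (trace S x) + arc_value lab S x) = (\<Sum>x\<in>?O. ?e (trace S x) - ?e x)"
    by (rule sum.cong [OF refl])
  then have "(\<Sum>x\<in>?O. r (trace S x)) + sum (arc_value lab S) ?O = 0"
    by (simp add: sum.distrib sum_orbit_gradient [OF permutation_trace])
  moreover have "(\<Sum>x\<in>?O. r (trace S x)) = sum r ?O"
    using sum_orbit_gradient [OF permutation_trace, of r S h] by (simp add: sum_subtractf)
  ultimately show ?thesis by (simp add: eq_neg_iff_add_eq_0)
qed

definition loop_at :: "'h set set \<Rightarrow> 'h \<Rightarrow> 'h set" where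
  "loop_at S h = orbit (trace S) h \<union> opp D ` orbit (trace S) h"

lemma loops_eq: "loops D S = loop_at S ` over D"
proof -
  let ?l = "\<lambda>h. directed_loop D S h \<union> opp D ` directed_loop D S h"
  have over: "?l h = loop_at S h" if "h \<in> over D" for h
    using that by (simp add: loop_at_def directed_loop_over)
  have under: "?l h = loop_at S (opp D h)" if "h \<in> half D" "h \<notin> over D" for h
  proof -
    have o: "opp D h \<in> over D" using that by simp
    have "directed_loop D S h = opp D ` orbit (trace S) (opp D h)"
      using directed_loop_reverse [of "opp D h" S] that by (simp add: directed_loop_over)
    moreover have "opp D ` opp D ` orbit (trace S) (opp D h) = id ` orbit (trace S) (opp D h)"
      unfolding image_image using orbit_trace_subset [OF o] by (intro image_cong) (auto simp: subset_iff)
    ultimately show ?thesis by (auto simp: loop_at_def)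
  qed
  show ?thesis
  proof (intro equalityI subsetI)
    fix C assume "C \<in> loops D S"
    then obtain h where "h \<in> half D" "C = ?l h" by (auto simp: loops_def)
    then show "C \<in> loop_at S ` over D"
      using over [of h] under [of h] by (cases "h \<in> over D") auto
  next
    fix C assume "C \<in> loop_at S ` over D"
    then show "C \<in> loops D S"
      using over by (fastforce simp: loops_def)
  qed
qed

lemma loop_at_over:
  assumes "h \<in> over D"
  shows "loop_at S h \<inter> over D = orbit (trace S) h"
  using orbit_trace_subset [OF assms, of S] by (auto simp: loop_at_def)

text \<open>
  Reversing a loop only changes the sign of its value, so it does not matter which half-edge is
  used to evaluate it.
\<close>

lemma loop_value_eq_0_iff:
  assumes h: "h \<in> over D"
  shows "loop_value D lab S (loop_at S h) = 0 \<longleftrightarrow> sum (arc_value lab S) (orbit (trace S) h) = 0"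
proof -
  define y where "y = (SOME y. y \<in> loop_at S h)"
  have "h \<in> loop_at S h"
    by (simp add: loop_at_def permutation_self_in_orbit [OF permutation_trace])
  then have "y \<in> loop_at S h" unfolding y_def by (rule someI)
  then obtain z where z: "z \<in> orbit (trace S) h" "y = z \<or> y = opp D z"
    by (auto simp: loop_at_def)
  have zo: "z \<in> over D" using orbit_trace_subset [OF h] z by auto
  have "orbit (trace S) z = orbit (trace S) h"
    by (rule orbit_eq_if_mem [OF permutation_trace z(1)])
  then have "chain_value D lab (loop_cycle D S y) = 0 \<longleftrightarrow> sum (arc_value lab S) (orbit (trace S) h) = 0"
    using z(2) loop_cycle_over [OF zo, of lab S] loop_cycle_reverse [OF zo, of lab S] by auto
  moreover have "y \<in> half D" using z(2) zo by auto
  ultimately show ?thesis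
    by (simp add: loop_value_def y_def [symmetric] h_map_hclass [OF D] loop_cycle_cycle [OF D])
qed

lemma null_loops_eq: "null_loops D lab S = null_orbits (trace S) (over D) (arc_value lab S)"
proof -
  let ?L = "{C \<in> loops D S. loop_value D lab S C = 0}"
  let ?O = "{C \<in> orbit (trace S) ` over D. sum (arc_value lab S) C = 0}"
  have "bij_betw (\<lambda>C. C \<inter> over D) ?L ?O"
  proof (rule bij_betw_byWitness [where f' = "\<lambda>C. C \<union> opp D ` C"])
    show "\<forall>C\<in>?L. C \<inter> over D \<union> opp D ` (C \<inter> over D) = C"
    proof
      fix C assume "C \<in> ?L"
      then obtain h where "h \<in> over D" "C = loop_at S h" unfolding loops_eq by blast
      then show "C \<inter> over D \<union> opp D ` (C \<inter> over D) = C"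
        using loop_at_over [of h S] unfolding loop_at_def by simp
    qed
    show "\<forall>C\<in>?O. (C \<union> opp D ` C) \<inter> over D = C"
    proof
      fix C assume "C \<in> ?O"
      then obtain h where "h \<in> over D" "C = orbit (trace S) h" by blast
      then show "(C \<union> opp D ` C) \<inter> over D = C"
        using loop_at_over [of h S] unfolding loop_at_def by simp
    qed
    show "(\<lambda>C. C \<inter> over D) ` ?L \<subseteq> ?O"
    proof (rule image_subsetI)
      fix C assume C: "C \<in> ?L"
      then obtain h where "h \<in> over D" "C = loop_at S h" unfolding loops_eq by blast
      then show "C \<inter> over D \<in> ?O"
        using C loop_at_over [of h S] loop_value_eq_0_iff [of h lab S] by simp
    qed
    show "(\<lambda>C. C \<union> opp D ` C) ` ?O \<subseteq> ?L"
    proof (rule image_subsetI)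
      fix C assume C: "C \<in> ?O"
      then obtain h where "h \<in> over D" "C = orbit (trace S) h" by blast
      then show "C \<union> opp D ` C \<in> ?L"
        using C loop_value_eq_0_iff [of h lab S] unfolding loops_eq loop_at_def by simp
    qed
  qed
  then show ?thesis
    unfolding null_loops_def null_orbits_def by (rule bij_betw_same_card)
qed

lemma sum_edge_value_crossing:
  assumes p: "p \<in> half D"
  shows "edge_value D lab p + edge_value D lab (rot D p) + edge_value D lab (rot D (rot D p))
    + edge_value D lab (inv (rot D) p) = 0"
proof -
  have c: "at_crossing D p" using p by (rule all_crossings)
  have "card (vertex_of D p) = 4" using c by (simp add: at_crossing_def)
  then have "distinct [p, rot D p, rot D (rot D p), rot D (rot D (rot D p))]"
    unfolding crossing_half_edges(1) [OF D c] by (intro card_distinct) simp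
  then show ?thesis
    using sum_edge_value_vertex [OF D p, of lab]
    unfolding crossing_half_edges(1) [OF D c] inv_rot_eq [OF p] by (simp add: add.assoc)
qed


section \<open>Null loops and the resmoothing of crossings\<close>

text \<open>
  At the crossing of \<open>p\<close> the under half-edges are \<open>inv rot p\<close> and \<open>rot p\<close>. A \<open>B\<close>-smoothing joins
  them to \<open>rot (rot p)\<close> and \<open>p\<close>, with arcs of value 0; an \<open>A\<close>-smoothing joins them to \<open>p\<close> and
  \<open>rot (rot p)\<close>, and the values of these two arcs add up to that of a circle around the crossing,
  which is 0.
\<close>

lemma reconnects_trace:
  assumes p: "p \<in> over D" and S: "vertex_of D p \<notin> S"
  shows "reconnects (over D) p (rot D (rot D p)) (trace S) (arc_value lab S)
     (trace (insert (vertex_of D p) S)) (arc_value lab (insert (vertex_of D p) S))"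
proof -
  let ?v = "vertex_of D p" and ?q = "rot D (rot D p)"
  let ?k = "inv (rot D) p" and ?l = "rot D p"
  have p': "p \<in> half D" using p by simp
  have rk: "inv (rot D) ?k = ?q" "rot D ?q = ?k"
    using crossing_half_edges(2) [OF D all_crossings [OF p']] by (metis rot_inv_simps(2))+
  have neq: "p \<noteq> ?q"
    using crossing_half_edges(3) [OF D all_crossings [OF p']] by simp
  have under: "u = ?k \<or> u = ?l" if "vertex_of D u = ?v" "u \<notin> over D" for u
  proof -
    have "u \<in> ?v" using self_in_vertex_of [OF D, of u] that by simp
    then show ?thesis
      using that p' p unfolding crossing_half_edges(1) [OF D all_crossings [OF p']]
      by (auto simp: rk)
  qed
  have ne_v: "trace S x \<noteq> p \<and> trace S x \<noteq> ?q" if "x \<in> over D" "vertex_of D (opp D x) \<noteq> ?v" for x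
  proof -
    have "vertex_of D (trace S x) = vertex_of D (opp D x)" using that(1) by (simp add: trace_eq)
    then have "vertex_of D (trace S x) \<noteq> ?v" using that(2) by simp
    then show ?thesis by (metis vertex_of_rot [OF D])
  qed
  have perm: "trace (insert ?v S) = transpose p ?q \<circ> trace S"
  proof
    fix x
    show "trace (insert ?v S) x = (transpose p ?q \<circ> trace S) x"
    proof (cases "x \<in> over D")
      case False
      then have "x \<noteq> p" "x \<noteq> ?q" using p by auto
      then show ?thesis using False by (simp add: trace_def)
    next
      case True
      show ?thesis
      proof (cases "vertex_of D (opp D x) = ?v")
        case False
        then have "trace (insert ?v S) x = trace S x" using True by (simp add: trace_eq)
        then show ?thesis using ne_v [OF True False] by simp
      next
        case v: True
        then have "opp D x = ?k \<or> opp D x = ?l" using True under by simp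
        then show ?thesis using True S by (auto simp: trace_eq rk)
      qed
    qed
  qed
  have inv_p: "inv (trace S) p = opp D ?l"
    using p p' S by (simp add: permutes_inv_eq [OF trace_permutes] trace_eq)
  have inv_q: "inv (trace S) ?q = opp D ?k"
    using p p' S by (simp add: permutes_inv_eq [OF trace_permutes] trace_eq rk)
  have "arc_value lab (insert ?v S) x = arc_value lab S x"
    if "x \<in> over D" "trace S x \<noteq> p" "trace S x \<noteq> ?q" for x
  proof -
    have "x \<noteq> inv (trace S) p" "x \<noteq> inv (trace S) ?q"
      using that permutes_inverses [OF trace_permutes] by metis+
    then have "opp D x \<noteq> ?l" "opp D x \<noteq> ?k"
      unfolding inv_p inv_q using opp_opp_half [OF over_half [OF that(1)]] by metis+
    then have "vertex_of D (opp D x) \<noteq> ?v" using under [of "opp D x"] that(1) by auto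
    then show ?thesis by (simp add: arc_value_def)
  qed
  moreover have "arc_value lab (insert ?v S) (opp D ?l) + arc_value lab (insert ?v S) (opp D ?k)
      = arc_value lab S (opp D ?l) + arc_value lab S (opp D ?k)"
    using sum_edge_value_crossing [OF p', of lab] p' S by (simp add: arc_value_def algebra_simps)
  ultimately show ?thesis
    unfolding reconnects_def inv_p inv_q
    using p p' neq finite_over trace_permutes perm by auto
qed

lemma crossings_eq: "crossings D = vertex_of D ` half D"
  using all_crossings by (auto simp: crossings_def vertices_def at_crossing_def)

lemma crossing_over:
  assumes "v \<in> crossings D"
  obtains p where "p \<in> over D" "v = vertex_of D p"
proof -
  from assms obtain h where h: "h \<in> half D" "v = vertex_of D h" by (auto simp: crossings_eq)
  show thesis
    using that [of h] that [of "rot D h"] h by (cases "h \<in> over D") auto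
qed

lemma finite_crossings: "finite (crossings D)"
  by (simp add: crossings_eq finite_half [OF D])

text \<open>
  In the all-\<open>B\<close> state every loop turns left at every crossing, so it runs around the face to its
  left.
\<close>

lemma orbit_trace_empty:
  assumes "h \<in> over D"
  shows "orbit (trace {}) h = face_of D h"
  unfolding face_of_def
  by (rule orbit_cong0 [where A = "over D"])
     (use assms in \<open>auto simp: trace_in_over trace_eq face_perm_def\<close>)

text \<open>
  In the all-\<open>A\<close> state every loop turns right and runs around the face to its right, in the
  direction opposite to \<open>face_perm\<close>. The corner after the under half-edge \<open>k\<close> lies between \<open>k\<close> and
  the over half-edge \<open>rot k\<close>, which represents it in the loop.
\<close>

lemma orbit_trace_crossings:
  assumes k: "k \<in> half D" "k \<notin> over D"
  shows "orbit (trace (crossings D)) (rot D k) = rot D ` face_of D k"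
proof -
  have perm: "permutation (face_perm D)"
    using face_perm_permutes [OF D] finite_half [OF D] by (auto simp: permutation_permutes)
  have "orbit (face_perm D) k \<subseteq> half D - over D"
    by (rule orbit_subset_closed) (use k in \<open>auto simp: face_perm_def\<close>)
  then have under: "x \<in> half D \<and> x \<notin> over D" if "x \<in> orbit (inv (face_perm D)) k" for x
    using that by (auto simp: orbit_inv_eq [OF perm])
  have "rot D ` orbit (inv (face_perm D)) k = orbit (trace (crossings D)) (rot D k)"
  proof (rule orbit_inverse)
    show "k \<in> orbit (inv (face_perm D)) k"
      by (simp add: orbit_inv_eq [OF perm] permutation_self_in_orbit [OF perm])
    fix x assume "x \<in> orbit (inv (face_perm D)) k"
    then have x: "x \<in> half D" "x \<notin> over D" using under by auto
    have "inv (face_perm D) x = opp D (rot D x)"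
      using x by (simp add: permutes_inv_eq [OF face_perm_permutes [OF D]] face_perm_def)
    then show "trace (crossings D) (rot D x) = rot D (inv (face_perm D) x)"
      using x by (simp add: trace_eq crossings_eq)
  qed
  then show ?thesis by (simp add: face_of_def orbit_inv_eq [OF perm])
qed

lemma h_reduced_corner:
  assumes "h_reduced D lab" "h \<in> half D" "rot D (rot D h) \<in> face_of D h"
  shows "edge_value D lab (rot D h) + edge_value D lab (rot D (rot D h)) \<noteq> 0"
proof -
  have perm: "permutation (face_perm D)"
    using face_perm_permutes [OF D] finite_half [OF D] by (auto simp: permutation_permutes)
  have eq: "face_of D h = face_of D (rot D (rot D h))"
    using orbit_eq_if_mem [OF perm] assms(3) by (simp add: face_of_def)
  have c: "at_crossing D h" using assms(2) by (rule all_crossings)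
  then have "h_map D lab (hclass D (crossing_curve D h)) \<noteq> 0"
    using assms(1) eq by (simp add: h_reduced_def)
  then have "chain_value D lab (turn D (rot D h)) \<noteq> 0"
    using h_map_hclass [OF D crossing_curve_cycle [OF D c eq], of lab]
    by (simp add: crossing_curve_def)
  then show ?thesis by (simp add: chain_value_turn)
qed

lemma null_loops_insert:
  assumes "v \<in> crossings D" "v \<notin> S"
  shows "null_loops D lab (insert v S) \<le> null_loops D lab S + 1"
    and "null_loops D lab S \<le> null_loops D lab (insert v S) + 1"
proof -
  obtain p where p: "p \<in> over D" "v = vertex_of D p" using assms(1) by (rule crossing_over)
  then have "reconnects (over D) p (rot D (rot D p)) (trace S) (arc_value lab S)
     (trace (insert v S)) (arc_value lab (insert v S))"
    using reconnects_trace assms(2) by simp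
  from null_orbits_reconnect [OF this]
  show "null_loops D lab (insert v S) \<le> null_loops D lab S + 1"
    and "null_loops D lab S \<le> null_loops D lab (insert v S) + 1"
    by (simp_all add: null_loops_eq)
qed

text \<open>
  The all-\<open>B\<close> state has all arc values 0. If the first \<open>A\<close>-smoothing splits a loop, then the
  corners after \<open>p\<close> and \<open>rot (rot p)\<close> lie in the same face, and the value of the redirected arc
  is, up to sign, that of the curve joining these corners through the crossing.
\<close>

lemma null_loops_single_A_smoothing:
  assumes red: "h_reduced D lab" and v: "v \<in> crossings D"
  shows "null_loops D lab {} = null_loops D lab {v} + 1"
proof -
  obtain p where p: "p \<in> over D" "v = vertex_of D p" using v by (rule crossing_over)
  let ?q = "rot D (rot D p)" and ?k = "inv (rot D) p"
  have p': "p \<in> half D" using p by simp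
  have rk: "inv (rot D) ?k = ?q"
    using crossing_half_edges(2) [OF D all_crossings [OF p']] by (metis rot_inv_simps(2))
  have inv_q: "inv (trace {}) ?q = opp D ?k"
    using p p' by (simp add: permutes_inv_eq [OF trace_permutes] trace_eq rk)
  have "reconnects (over D) p ?q (trace {}) (arc_value lab {}) (trace {v}) (arc_value lab {v})"
    using reconnects_trace [OF p(1), of "{}" lab] p(2) by simp
  then have "null_orbits (trace {}) (over D) (arc_value lab {})
      = null_orbits (trace {v}) (over D) (arc_value lab {v}) + 1"
  proof (rule null_orbits_first_reconnect [where u = "\<lambda>_. 0"])
    show "arc_value lab {} x = 0 - 0" for x by (simp add: arc_value_def)
    assume "?q \<in> orbit (trace {}) p"
    then have "edge_value D lab (rot D p) + edge_value D lab ?q \<noteq> 0"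
      using h_reduced_corner [OF red p'] by (simp add: orbit_trace_empty p)
    moreover have "(edge_value D lab ?k + edge_value D lab p)
        + (edge_value D lab (rot D p) + edge_value D lab ?q) = 0"
      using sum_edge_value_crossing [OF p', of lab] by (simp add: algebra_simps)
    ultimately have "edge_value D lab ?k + edge_value D lab p \<noteq> 0" by auto
    then show "arc_value lab {v} (inv (trace {}) ?q) \<noteq> 0 - 0"
      using p p' by (simp add: inv_q arc_value_def)
  qed
  then show ?thesis by (simp add: null_loops_eq)
qed

text \<open>
  The loops of the all-\<open>A\<close> state, pushed off to the left, leave their faces: their arc values are
  not zero, but the gradient of the edge values.
\<close>

lemma arc_value_crossings:
  assumes "x \<in> over D"
  shows "arc_value lab (crossings D) x = edge_value D lab (trace (crossings D) x) - edge_value D lab x"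
  using assms by (simp add: arc_value_def trace_eq crossings_eq edge_value_opp [OF D])

text \<open>
  As for the all-\<open>B\<close> state, but with the corners after \<open>inv rot p\<close> and \<open>rot p\<close>, and with the edge
  values as the potential.
\<close>

lemma null_loops_single_B_smoothing:
  assumes red: "h_reduced D lab" and v: "v \<in> crossings D"
  shows "null_loops D lab (crossings D) = null_loops D lab (crossings D - {v}) + 1"
proof -
  let ?A = "crossings D"
  obtain p where p: "p \<in> over D" "v = vertex_of D p" using v by (rule crossing_over)
  let ?q = "rot D (rot D p)" and ?k = "inv (rot D) p"
  have p': "p \<in> half D" using p by simp
  have inv_q: "inv (trace ?A) ?q = opp D (rot D p)"
    using p p' by (simp add: permutes_inv_eq [OF trace_permutes] trace_eq crossings_eq)
  have "reconnects (over D) p ?q (trace (?A - {v})) (arc_value lab (?A - {v})) (trace ?A) (arc_value lab ?A)"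
    using reconnects_trace [OF p(1), of "?A - {v}" lab] p(2) v by (simp add: insert_absorb)
  then have "null_orbits (trace ?A) (over D) (arc_value lab ?A)
      = null_orbits (trace (?A - {v})) (over D) (arc_value lab (?A - {v})) + 1"
  proof (rule null_orbits_first_reconnect [OF reconnects_sym, where u = "edge_value D lab"])
    show "arc_value lab ?A x = edge_value D lab (trace ?A x) - edge_value D lab x"
      if "x \<in> over D" for x
      using that by (rule arc_value_crossings)
    assume "?q \<in> orbit (trace ?A) p"
    then have "?q \<in> rot D ` face_of D ?k"
      using orbit_trace_crossings [of ?k] p p' by simp
    then have "rot D (rot D ?k) \<in> face_of D ?k"
      using permutes_inj [OF rot_permutes [OF D]] by (auto dest: injD)
    then have "edge_value D lab p + edge_value D lab (rot D p) \<noteq> 0"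
      using h_reduced_corner [OF red, of ?k] p' by simp
    then show "arc_value lab (?A - {v}) (inv (trace ?A) ?q) \<noteq>
        edge_value D lab p - edge_value D lab (inv (trace ?A) ?q)"
      using p p' by (simp add: inv_q arc_value_def edge_value_opp [OF D])
  qed
  then show ?thesis by (simp add: null_loops_eq)
qed

lemma null_loops_bound_from_B_state:
  assumes "h_reduced D lab" "S \<subseteq> crossings D" "S \<noteq> {}"
  shows "null_loops D lab S + 2 \<le> null_loops D lab {} + card S"
  using finite_crossings assms(2,3)
proof (rule growth_bound_after_drop)
  show "null_loops D lab (insert v T) \<le> null_loops D lab T + 1"
    if "v \<in> crossings D" "v \<notin> T" for v T
    using null_loops_insert(1) [OF that] .
  show "null_loops D lab {v} + 1 \<le> null_loops D lab {}" if "v \<in> crossings D" for v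
    using null_loops_single_A_smoothing [OF assms(1) that] by simp
qed

lemma null_loops_bound_from_A_state:
  assumes "h_reduced D lab" "S \<subseteq> crossings D" "S \<noteq> crossings D"
  shows "null_loops D lab S + 2 \<le> null_loops D lab (crossings D) + card (crossings D - S)"
proof -
  let ?F = "\<lambda>T. null_loops D lab (crossings D - T)"
  have "?F (crossings D - S) + 2 \<le> ?F {} + card (crossings D - S)"
  proof (rule growth_bound_after_drop [OF finite_crossings])
    show "crossings D - S \<noteq> {}" using assms by auto
    fix T v assume v: "v \<in> crossings D" "v \<notin> T"
    then have "crossings D - T = insert v (crossings D - insert v T)" by auto
    then show "?F (insert v T) \<le> ?F T + 1"
      using null_loops_insert(2) [OF v(1), of "crossings D - insert v T" lab] by simp
  next
    fix v assume "v \<in> crossings D"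
    then show "?F {v} + 1 \<le> ?F {}" using null_loops_single_B_smoothing [OF assms(1)] by simp
  qed auto
  moreover have "crossings D - (crossings D - S) = S" using assms(2) by auto
  ultimately show ?thesis by simp
qed

text \<open>
  The loops of both extreme states bound faces.
\<close>

lemma loop_value_extreme:
  assumes "S = {} \<or> S = crossings D" "C \<in> loops D S"
  shows "loop_value D lab S C = 0"
proof -
  from assms(2) obtain h where h: "h \<in> over D" "C = loop_at S h" by (auto simp: loops_eq)
  have "sum (arc_value lab S) (orbit (trace S) h) = 0"
  proof (cases "S = {}")
    case True
    then show ?thesis by (simp add: arc_value_def)
  next
    case False
    then have "sum (arc_value lab S) (orbit (trace S) h)
        = (\<Sum>x\<in>orbit (trace S) h. edge_value D lab (trace S x) - edge_value D lab x)"
      using assms(1) orbit_trace_subset [OF h(1), of S]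
      by (intro sum.cong) (auto simp: arc_value_crossings)
    then show ?thesis by (simp add: sum_orbit_gradient [OF permutation_trace])
  qed
  then show ?thesis using h by (simp add: loop_value_eq_0_iff)
qed

lemma null_loops_extreme:
  assumes "S = {} \<or> S = crossings D"
  shows "null_loops D lab S = card (orbit (trace S) ` over D)"
proof -
  have "sum (arc_value lab S) C = 0" if C: "C \<in> orbit (trace S) ` over D" for C
  proof -
    from C obtain h where h: "h \<in> over D" "C = orbit (trace S) h" by auto
    then show ?thesis
      using loop_value_extreme [OF assms, of "loop_at S h" lab]
      by (simp add: loops_eq loop_value_eq_0_iff)
  qed
  then have "{C \<in> orbit (trace S) ` over D. sum (arc_value lab S) C = 0} = orbit (trace S) ` over D"
    by auto
  then show ?thesis by (simp add: null_loops_eq null_orbits_def)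
qed


section \<open>Faces and genus\<close>

text \<open>
  The faces fall into those whose corners follow over half-edges, traced by the all-\<open>B\<close> state, and
  those whose corners follow under half-edges, traced by the all-\<open>A\<close> state.
\<close>

lemma card_faces:
  "card (faces D) = null_loops D lab (crossings D) + null_loops D lab {}"
proof -
  let ?U = "half D - over D"
  have perm: "permutation (face_perm D)"
    using face_perm_permutes [OF D] finite_half [OF D] by (auto simp: permutation_permutes)
  have self: "h \<in> face_of D h" for h
    by (simp add: face_of_def permutation_self_in_orbit [OF perm])
  have "half D = over D \<union> ?U" by auto
  then have faces: "faces D = face_of D ` over D \<union> face_of D ` ?U"
    unfolding faces_def by (metis image_Un)
  have over: "face_of D ` over D = orbit (trace {}) ` over D"
    by (simp add: orbit_trace_empty cong: image_cong)
  have under_sub: "face_of D h \<subseteq> ?U" if "h \<in> ?U" for h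
    unfolding face_of_def using that by (intro orbit_subset_closed) (auto simp: face_perm_def)
  have disj: "face_of D ` over D \<inter> face_of D ` ?U = {}"
    using self under_sub by blast
  have "rot D ` ?U = over D"
  proof
    show "over D \<subseteq> rot D ` ?U"
    proof
      fix p assume "p \<in> over D"
      then have "inv (rot D) p \<in> ?U" by simp
      then have "rot D (inv (rot D) p) \<in> rot D ` ?U" by (rule imageI)
      then show "p \<in> rot D ` ?U" by simp
    qed
  qed auto
  then have "orbit (trace (crossings D)) ` over D
      = (\<lambda>h. orbit (trace (crossings D)) (rot D h)) ` ?U"
    by (metis image_image)
  also have "\<dots> = (`) (rot D) ` face_of D ` ?U"
    unfolding image_image by (rule image_cong) (simp_all add: orbit_trace_crossings)
  finally have under: "card (face_of D ` ?U) = card (orbit (trace (crossings D)) ` over D)"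
    using permutes_inj [OF rot_permutes [OF D]]
    by (simp add: card_image inj_on_def inj_image_eq_iff)
  show ?thesis
    unfolding faces
    using card_Un_disjoint [OF _ _ disj] finite_half [OF D] finite_over
    by (simp add: null_loops_extreme under over)
qed

text \<open>
  Passing from the all-\<open>B\<close> to the all-\<open>A\<close> state flips the parity of the number of loops once for
  each crossing.
\<close>

lemma even_card_faces: "even (card (faces D)) \<longleftrightarrow> even (card (crossings D))"
proof -
  let ?N = "\<lambda>S. card (orbit (trace S) ` over D)"
  have parity: "even (?N S + ?N {} + card S)" if "finite S" "S \<subseteq> crossings D" for S
    using that
  proof (induction S rule: finite_induct)
    case empty
    then show ?case by simp
  next
    case (insert v S)
    then obtain p where p: "p \<in> over D" "v = vertex_of D p" using crossing_over by blast
    have "reconnects (over D) p (rot D (rot D p)) (trace S) (arc_value (\<lambda>_. 0 :: int) S)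
        (trace (insert v S)) (arc_value (\<lambda>_. 0) (insert v S))"
      using reconnects_trace p insert by simp
    from card_orbits_reconnect_parity [OF this] show ?case
      using insert by auto
  qed
  have "card (faces D) = ?N (crossings D) + ?N {}"
    using card_faces [of "\<lambda>_. 0 :: int"] by (simp add: null_loops_extreme)
  then show ?thesis using parity [OF finite_crossings] by auto
qed

lemma card_edges: "card (edges D) = 2 * card (crossings D)"
proof -
  have "4 * card (crossings D) = card (\<Union>(crossings D))"
  proof (rule card_partition [OF finite_crossings])
    show "finite (\<Union>(crossings D))"
      using finite_half [OF D] vertex_of_subset [OF D] by (auto simp: crossings_eq intro: finite_subset)
    show "card v = 4" if "v \<in> crossings D" for v using that by (simp add: crossings_def)
    show "v \<inter> v' = {}" if v: "v \<in> crossings D" "v' \<in> crossings D" "v \<noteq> v'" for v v'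
    proof -
      from v obtain h h' where "v = vertex_of D h" "v' = vertex_of D h'"
        by (auto simp: crossings_eq)
      then show ?thesis using v(3) vertex_of_eq [OF D] by blast
    qed
  qed
  moreover have "\<Union>(crossings D) = half D"
    using vertex_of_subset [OF D] self_in_vertex_of [OF D] by (auto simp: crossings_eq)
  moreover have "2 * card (edges D) = card (\<Union>(edges D))"
  proof (rule card_partition)
    show "finite (edges D)" "finite (\<Union>(edges D))"
      using finite_half [OF D] by (auto simp: edges_def)
    show "card e = 2" if "e \<in> edges D" for e
    proof -
      from that obtain h where h: "h \<in> half D" "e = {h, opp D h}" by (auto simp: edges_def)
      then show ?thesis using opp_neq [OF D h(1)] by simp
    qed
    show "e \<inter> e' = {}" if "e \<in> edges D" "e' \<in> edges D" "e \<noteq> e'" for e e'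
      using that permutes_inj [OF opp_permutes [OF D]] by (auto simp: edges_def dest: injD)
  qed
  moreover have "\<Union>(edges D) = half D" by (auto simp: edges_def)
  ultimately show ?thesis by simp
qed

lemma genus_eq: "2 * genus D = 2 + int (card (crossings D)) - int (card (faces D))"
proof -
  have "vertices D = crossings D" by (simp add: vertices_def crossings_eq)
  then have "2 - euler_char D = 2 + int (card (crossings D)) - int (card (faces D))"
    by (simp add: euler_char_def card_edges)
  moreover from this have "even (2 - euler_char D)"
    unfolding \<open>2 - euler_char D = _\<close> using even_card_faces by simp
  then have "2 * genus D = 2 - euler_char D"
    unfolding genus_def by (rule dvd_mult_div_cancel)
  ultimately show ?thesis by simp
qed

end


section \<open>Extreme terms of the polynomial\<close>

definition state_term ::
    "('h, 'b) vdiagram_scheme \<Rightarrow> ('h set \<Rightarrow> 'g) \<Rightarrow> 'h set set \<Rightarrow> 'g::ab_group_add R_ring" where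
  "state_term D lab S =
     A_power (int (card S) - int (card (crossings D - S)))
     * (- A_power 2 - A_power (- 2)) ^ null_loops D lab S
     * (\<Prod>C\<in>loops D S. X_var (loop_value D lab S C))"

text \<open>
  Every null loop contributes the degrees 2 and -2, and the \<open>X\<close> variables contribute none.
\<close>

lemma degree_le_state_term:
  assumes d: "d = 1 \<or> d = - 1"
    and b: "d * (int (card S) - int (card (crossings D - S))) + 2 * int (null_loops D lab S) \<le> b"
  shows "degree_le d b (state_term D lab S)"
proof -
  let ?a = "int (card S) - int (card (crossings D - S))" and ?n = "int (null_loops D lab S)"
  have "degree_le d (d * (?n * (2 * d))) ((- A_power 2 - A_power (- 2)) ^ null_loops D lab S)"
    using d by (intro extreme_term_degree_le extreme_term_power extreme_term_loop_factor)
  then have "degree_le d (d * ?a + d * (?n * (2 * d)) + 0) (state_term D lab S)"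
    unfolding state_term_def by (intro degree_le_mult degree_le_A_power degree_le_prod_X_var)
  then show ?thesis
    by (rule degree_le_mono) (use b d in auto)
qed

lemma extreme_term_state_term:
  fixes lab :: "'h set \<Rightarrow> 'g::ab_group_add"
  assumes d: "d = 1 \<or> d = - 1"
    and null: "\<And>C. C \<in> loops D S \<Longrightarrow> loop_value D lab S C = 0"
  shows "extreme_term d (int (card S) - int (card (crossings D - S)) + 2 * d * int (null_loops D lab S))
     (state_term D lab S)"
proof -
  let ?a = "int (card S) - int (card (crossings D - S))" and ?n = "int (null_loops D lab S)"
  have "state_term D lab S = A_power ?a * (- A_power 2 - A_power (- 2)) ^ null_loops D lab S"
    by (simp add: state_term_def null X_var_zero)
  moreover have "extreme_term d (?a + ?n * (2 * d))
      (A_power ?a * (- A_power 2 - A_power (- 2)) ^ null_loops D lab S :: 'g R_ring)"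
    using d by (intro extreme_term_mult extreme_term_A_power extreme_term_power extreme_term_loop_factor)
  ultimately show ?thesis by (simp add: algebra_simps)
qed

lemma extreme_term_sum:
  assumes "finite I" "i \<in> I" "extreme_term d n (f i)"
    and "\<And>j. j \<in> I \<Longrightarrow> j \<noteq> i \<Longrightarrow> degree_le d (d * n - 1) (f j)"
  shows "extreme_term d n (\<Sum>j\<in>I. f j)"
  unfolding sum.remove [OF assms(1,2)]
  by (intro extreme_term_add assms(3) degree_le_sum) (use assms(4) in auto)

context alternating_crossing_diagram
begin

text \<open>
  All loops of the all-\<open>A\<close> state are null, so its term has no \<open>X\<close> variables, while the degrees of
  every other state stay below by at least 4.
\<close>

lemma extreme_term_A_state:
  assumes red: "h_reduced D lab"
  shows "extreme_term 1 (int (card (crossings D)) + 2 * int (null_loops D lab (crossings D)))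
     (\<Sum>S\<in>states D. state_term D lab S)"
proof (rule extreme_term_sum [where i = "crossings D"])
  show "finite (states D)" "crossings D \<in> states D"
    using finite_crossings by (auto simp: states_def)
  show "extreme_term 1 (int (card (crossings D)) + 2 * int (null_loops D lab (crossings D)))
      (state_term D lab (crossings D))"
    using extreme_term_state_term [of 1 D "crossings D" lab] by (simp add: loop_value_extreme)
  fix S assume S: "S \<in> states D" "S \<noteq> crossings D"
  then have sub: "S \<subseteq> crossings D" by (simp add: states_def)
  have card: "card (crossings D - S) + card S = card (crossings D)"
    using card_Diff_subset [OF finite_subset [OF sub finite_crossings] sub]
      card_mono [OF finite_crossings sub] by simp
  show "degree_le 1 (1 * (int (card (crossings D)) + 2 * int (null_loops D lab (crossings D))) - 1)
      (state_term D lab S)"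
    by (rule degree_le_state_term) (use null_loops_bound_from_A_state [OF red sub S(2)] card in auto)
qed

lemma extreme_term_B_state:
  assumes red: "h_reduced D lab"
  shows "extreme_term (- 1) (- int (card (crossings D)) - 2 * int (null_loops D lab {}))
     (\<Sum>S\<in>states D. state_term D lab S)"
proof (rule extreme_term_sum [where i = "{}"])
  show "finite (states D)" "{} \<in> states D"
    using finite_crossings by (auto simp: states_def)
  show "extreme_term (- 1) (- int (card (crossings D)) - 2 * int (null_loops D lab {}))
      (state_term D lab {})"
    using extreme_term_state_term [of "- 1" D "{}" lab] by (simp add: loop_value_extreme)
  fix S assume S: "S \<in> states D" "S \<noteq> {}"
  then have sub: "S \<subseteq> crossings D" by (simp add: states_def)
  have card: "card (crossings D - S) + card S = card (crossings D)"
    using card_Diff_subset [OF finite_subset [OF sub finite_crossings] sub]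
      card_mono [OF finite_crossings sub] by simp
  show "degree_le (- 1) (- 1 * (- int (card (crossings D)) - 2 * int (null_loops D lab {})) - 1)
      (state_term D lab S)"
    by (rule degree_le_state_term) (use null_loops_bound_from_B_state [OF red sub S(2)] card in auto)
qed

end


section \<open>The circle without crossings\<close>

text \<open>
  The two half-edges at a bivalent vertex form one edge, so nothing else can be reached from it.
\<close>

lemma bivalent_diagram:
  assumes D: "virtual_link_diagram D" and conn: "connected_diagram D"
    and h: "h \<in> half D" "\<not> at_crossing D h"
  shows "half D = {h, rot D h}" "rot D h \<noteq> h" "rot D (rot D h) = h"
    and "k \<in> half D \<Longrightarrow> opp D k = rot D k" "vertices D = {half D}" "crossings D = {}"
proof -
  have card: "card (vertex_of D h) = 2"
    using D h by (auto simp: virtual_link_diagram_def at_crossing_def)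
  have opp_rot: "opp D k = rot D k" if "k \<in> vertex_of D h" for k
  proof -
    have "k \<in> half D" using vertex_of_subset [OF D h(1)] that by auto
    moreover have "card (vertex_of D k) = 2" using vertex_of_eq [OF D that] card by simp
    ultimately show ?thesis using D by (auto simp: virtual_link_diagram_def)
  qed
  have "half D \<subseteq> vertex_of D h"
  proof
    fix k assume "k \<in> half D"
    then have "(h, k) \<in> {(x, y). x \<in> half D \<and> (y = rot D x \<or> y = opp D x)}\<^sup>*"
      using conn h by (auto simp: connected_diagram_def)
    then show "k \<in> vertex_of D h"
    proof induction
      case base
      show ?case by (rule self_in_vertex_of [OF D])
    next
      case (step y z)
      then show ?case
        using opp_rot by (auto simp: vertex_of_def intro: orbit.step)
    qed
  qed
  then have half: "vertex_of D h = half D"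
    using vertex_of_subset [OF D h(1)] by auto
  show opp: "opp D k = rot D k" if "k \<in> half D" for k
    using opp_rot that half by simp
  have "rot D h \<in> half D" using rot_in_half [OF D] h by simp
  moreover show ne: "rot D h \<noteq> h" using opp_neq [OF D h(1)] opp h by simp
  ultimately have "card {h, rot D h} = card (half D)" "{h, rot D h} \<subseteq> half D"
    using card half h by auto
  then show "half D = {h, rot D h}"
    using finite_half [OF D] by (metis card_subset_eq)
  show "rot D (rot D h) = h"
    using opp_opp [OF D h(1)] opp h \<open>rot D h \<in> half D\<close> by simp
  have "vertex_of D k = half D" if "k \<in> half D" for k
    using vertex_of_eq [OF D, of k h] that half by simp
  then show "vertices D = {half D}"
    using h by (auto simp: vertices_def)
  then show "crossings D = {}"
    using card half by (auto simp: crossings_def)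
qed

text \<open>
  There are no over half-edges here to represent the loops, but there is just one state.
\<close>

lemma unknotted_circle:
  assumes D: "virtual_link_diagram D" and conn: "connected_diagram D"
    and h: "h \<in> half D" "\<not> at_crossing D h"
  shows "crossings D = {}" "genus D = 0"
    and "arrow_poly D lab = - A_power 2 - A_power (- 2)"
proof -
  note bi = bivalent_diagram [OF D conn h]
  show cr: "crossings D = {}" by (rule bi(6))
  have rot_rot: "rot D (rot D k) = k" if "k \<in> half D" for k
    using that bi(1,3) by auto
  have inv_rot: "inv (rot D) k = rot D k" if "k \<in> half D" for k
    using rot_rot [OF that] by (metis rot_inv(2) [OF D])
  have "face_perm D k = k" if "k \<in> half D" for k
    using that by (simp add: face_perm_def bi(4) rot_inv [OF D])
  then have face: "face_of D k = {k}" if "k \<in> half D" for k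
    using that by (simp add: face_of_def orbit_eq_singleton_iff)
  have "faces D = {{h}, {rot D h}}"
    using face by (auto simp: faces_def bi(1))
  then have "card (faces D) = 2" using bi(2) by auto
  moreover have "edges D = {half D}"
    using bi(3) bi(4) by (auto simp: edges_def bi(1))
  ultimately show "genus D = 0"
    by (simp add: genus_def euler_char_def bi(5))
  have smoothing: "smoothing D {} k = inv (rot D) k" if "k \<in> half D" for k
    using inv_rot [OF that] by (simp add: smoothing_def)
  have "loop_next D {} k = k" if "k \<in> half D" for k
    using that by (simp add: loop_next_def bi(4) smoothing rot_in_half [OF D] rot_inv [OF D])
  then have dl: "directed_loop D {} k = {k}" if "k \<in> half D" for k
    using that by (simp add: directed_loop_def orbit_eq_singleton_iff)
  have loops: "loops D {} = {half D}"
    using dl bi(3) bi(4) by (auto simp: loops_def bi(1))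
  have "loop_cycle D {} k = (\<lambda>_. 0)" if "k \<in> half D" for k
    using that by (simp add: loop_cycle_def fun_eq_iff dl smoothing opp_in_half [OF D])
  then have "h_map D lab (hclass D (loop_cycle D {} k)) = 0" if "k \<in> half D" for k
    using h_map_hclass [OF D loop_cycle_cycle [OF D that, of "{}"]] that by (simp add: chain_value_zero)
  moreover have "(SOME k. k \<in> half D) \<in> half D" using h(1) by (rule someI)
  ultimately have "loop_value D lab {} (half D) = 0"
    by (simp add: loop_value_def)
  then show "arrow_poly D lab = - A_power 2 - A_power (- 2)"
    by (simp add: arrow_poly_def states_def cr loops null_loops_def A_power_zero X_var_zero cong: conj_cong)
qed


section \<open>The breadth\<close>

theorem corollary3p37:
  fixes D :: "'h vdiagram"
    and lab :: "'h set \<Rightarrow> 'g::ab_group_add"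
  assumes "virtual_link_diagram D"
    and "connected_diagram D"
    and "alternating D"
    and "h_reduced D lab"
  shows "arrow_poly D lab \<noteq> 0 \<and>
         breadth_A (arrow_poly D lab) = 4 * int (card (crossings D)) - 4 * genus D + 4"
proof (cases "\<forall>h \<in> half D. at_crossing D h")
  case True
  then interpret alternating_crossing_diagram D
    using assms by unfold_locales auto
  have "arrow_poly D lab = (\<Sum>S\<in>states D. state_term D lab S)"
    by (simp add: arrow_poly_def state_term_def)
  then show ?thesis
    using breadth_A_eq [OF extreme_term_A_state extreme_term_B_state, OF assms(4) assms(4)]
      genus_eq card_faces [of lab] by simp
next
  case False
  then obtain h where h: "h \<in> half D" "\<not> at_crossing D h" by auto
  have "arrow_poly D lab \<noteq> 0 \<and> breadth_A (arrow_poly D lab) = 2 - (- 2)"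
    unfolding unknotted_circle(3) [OF assms(1,2) h]
    using extreme_term_loop_factor [of 1] extreme_term_loop_factor [of "- 1"]
    by (intro breadth_A_eq) simp_all
  then show ?thesis
    using unknotted_circle(1,2) [OF assms(1,2) h] by simp
qed

end
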